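(* Let $K_1, K_2$ be Hilbert spaces and let $T, T' \in B(K_1,K_2)$. Put $H = K_1 \oplus K_2$. Then the following are equivalent: (1) The two subspace system $(H; K_1\oplus 0, \mathrm{graph}(T))$ is boundedly isomorphic to the two subspace system $(H; K_1\oplus 0, \mathrm{graph}(T'))$. (2) The derived three subspace systems $(H; K_1\oplus 0, 0\oplus K_2, \mathrm{graph}(T))$ and $(H; K_1\oplus 0, 0\oplus K_2, \mathrm{graph}(T'))$ are boundedly isomorphic. (3) The Hilbert representations constructed by $T: K_1\to K_2$ and by $T': K_1\to K_2$ are boundedly isomorphic as Hilbert representations of the $A_2$-Dynkin quiver. (4) The operator ranges $\mathrm{ran}\, T$ and $\mathrm{ran}\, T'$ are unitarily equivalent and $\dim \ker T = \dim \ker T'$. (5) There exist invertible operators $L\in B(K_2)$ and $M\in B(K_1)$ such that $T = L T' M$.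
   Context: $B(K_1,K_2)$ is the set of bounded linear operators from $K_1$ to $K_2$, and $B(K)=B(K,K)$. For an operator $T$ from $K_1$ to $K_2$, $\mathrm{graph}(T)=\{(x,Tx)\}\subset K_1\oplus K_2$ with $x$ ranging over the domain of $T$. A system of $n$ subspaces $(H;E_1,\dots,E_n)$ (an $n$-subspace system) consists of a Hilbert space $H$ and closed subspaces $E_1,\dots,E_n$ of $H$. Two such systems $(H;E_1,\dots,E_n)$ and $(L;F_1,\dots,F_n)$ are boundedly isomorphic if there is a bounded invertible linear operator $\varphi:H\to L$ with $\varphi(E_i)=F_i$ for $i=1,\dots,n$. The derived three subspace system of $(H;E_1,E_2)$ is $(H;E_1,E_1^\perp,E_2)$. The $A_2$-Dynkin quiver is the directed graph with two vertices $1,2$ and a single arrow $\alpha:1\to 2$. A Hilbert representation of it is a pair of Hilbert spaces $H_1,H_2$ together with a bounded linear operator $f_\alpha:H_1\to H_2$. The Hilbert representation constructed by an operator $T:K_1\to K_2$ is the one with $H_1=K_1$, $H_2=K_2$, $f_\alpha=T$. Two Hilbert representations $f:H_1\to H_2$ and $g:G_1\to G_2$ are boundedly isomorphic if there are bounded invertible operators $\varphi_1\in B(H_1,G_1)$ and $\varphi_2\in B(H_2,G_2)$ with $\varphi_2 f = g\varphi_1$. Linear subspaces (operator ranges) $\mathscr{R},\mathscr{S}$ of a Hilbert space $K$ are unitarily equivalent if there is a unitary $U\in B(K)$ with $\mathscr{S}=U\mathscr{R}$. $\dim$ denotes Hilbert space dimension (cardinality of an orthonormal basis). An invertible operator in $B(K)$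 means one with bounded everywhere-defined inverse. *)

theory Defs
  imports "HOL-Analysis.Analysis"
begin

section \<open>Complex Hilbert spaces\<close>

text \<open>
  A complex Hilbert space is a complete real inner product space that also carries a complex
  scalar multiplication and a sesquilinear form (linear in the first argument) whose real part is
  the given real inner product. Norm, topology and completeness are thus those of the library,
  and \<open>cinner x x = (norm x)\<^sup>2\<close> (lemma \<open>cinner_self\<close>). Dimension zero is allowed.
\<close>

class chilbert_space = real_inner + complete_space +
  fixes scaleC :: "complex \<Rightarrow> 'a \<Rightarrow> 'a"  (infixr \<open>*\<^sub>C\<close> 75)
    and cinner :: "'a \<Rightarrow> 'a \<Rightarrow> complex"
  assumes scaleC_add_right: "a *\<^sub>C (x + y) = a *\<^sub>C x + a *\<^sub>C y"
    and scaleC_add_left: "(a + b) *\<^sub>C x = a *\<^sub>C x + b *\<^sub>C x"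
    and scaleC_scaleC: "a *\<^sub>C b *\<^sub>C x = (a * b) *\<^sub>C x"
    and scaleC_of_real: "complex_of_real r *\<^sub>C x = r *\<^sub>R x"
    and cinner_commute: "cinner x y = cnj (cinner y x)"
    and cinner_add_left: "cinner (x + y) z = cinner x z + cinner y z"
    and cinner_scaleC_left: "cinner (a *\<^sub>C x) y = a * cinner x y"
    and Re_cinner: "Re (cinner x y) = inner x y"

lemma cinner_self: "cinner x x = complex_of_real ((norm (x::'a::chilbert_space))\<^sup>2)"
proof -
  have "Im (cinner x x) = 0"
    using arg_cong[OF cinner_commute[of x x], of Im] by simp
  then show ?thesis
    by (simp add: complex_eq_iff Re_cinner power2_norm_eq_inner)
qed

instantiation complex :: chilbert_space
begin

definition scaleC_complex :: "complex \<Rightarrow> complex \<Rightarrow> complex"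
  where "scaleC_complex a x = a * x"

definition cinner_complex :: "complex \<Rightarrow> complex \<Rightarrow> complex"
  where "cinner_complex x y = x * cnj y"

instance
  by standard
    (auto simp: scaleC_complex_def cinner_complex_def algebra_simps inner_complex_def
      scaleR_conv_of_real)

end

text \<open>The Hilbert space direct sum of two Hilbert spaces is their product type.\<close>

instantiation prod :: (chilbert_space, chilbert_space) chilbert_space
begin

definition scaleC_prod :: "complex \<Rightarrow> 'a \<times> 'b \<Rightarrow> 'a \<times> 'b"
  where "scaleC_prod a x = (a *\<^sub>C fst x, a *\<^sub>C snd x)"

definition cinner_prod :: "'a \<times> 'b \<Rightarrow> 'a \<times> 'b \<Rightarrow> complex"
  where "cinner_prod x y = cinner (fst x) (fst y) + cinner (snd x) (snd y)"

instance
proof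
  fix x y z :: "'a \<times> 'b" and a b :: complex and r :: real
  show "cinner x y = cnj (cinner y x)"
    unfolding cinner_prod_def
    by (metis cinner_commute complex_cnj_add)
qed (auto simp: scaleC_prod_def cinner_prod_def scaleC_add_right scaleC_add_left scaleC_scaleC
       scaleC_of_real cinner_add_left cinner_scaleC_left Re_cinner inner_prod_def
       algebra_simps prod_eq_iff)

end

section \<open>Subspaces, dimension and operators\<close>

definition csubspace :: "'a::chilbert_space set \<Rightarrow> bool"
  where "csubspace S \<longleftrightarrow>
    0 \<in> S \<and> (\<forall>x\<in>S. \<forall>y\<in>S. x + y \<in> S) \<and> (\<forall>a. \<forall>x\<in>S. a *\<^sub>C x \<in> S)"

definition orth_compl :: "'a::chilbert_space set \<Rightarrow> 'a set"
  where "orth_compl S = {x. \<forall>y\<in>S. cinner x y = 0}"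

definition orthonormal_basis_of :: "'a::chilbert_space set \<Rightarrow> 'a set \<Rightarrow> bool"
  where "orthonormal_basis_of B S \<longleftrightarrow>
    (\<forall>x\<in>B. norm x = 1) \<and> (\<forall>x\<in>B. \<forall>y\<in>B. x \<noteq> y \<longrightarrow> cinner x y = 0) \<and>
    closure (csubspace hull B) = S"

text \<open>
  Hilbert space dimension of a closed subspace, as a cardinal: infinite (also uncountable)
  dimensions are distinguished. Two cardinals are compared by \<open>ordIso\<close>, not by equality.
\<close>

definition hilbert_dim :: "'a::chilbert_space set \<Rightarrow> 'a rel"
  where "hilbert_dim S = card_of (SOME B. orthonormal_basis_of B S)"

definition bounded_clinear :: "('a::chilbert_space \<Rightarrow> 'b::chilbert_space) \<Rightarrow> bool"
  where "bounded_clinear T \<longleftrightarrow> bounded_linear T \<and> (\<forall>a x. T (a *\<^sub>C x) = a *\<^sub>C T x)"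

definition invertible_op :: "('a::chilbert_space \<Rightarrow> 'b::chilbert_space) \<Rightarrow> bool"
  where "invertible_op T \<longleftrightarrow>
    bounded_clinear T \<and> (\<exists>S. bounded_clinear S \<and> S \<circ> T = id \<and> T \<circ> S = id)"

definition unitary_op :: "('a::chilbert_space \<Rightarrow> 'a) \<Rightarrow> bool"
  where "unitary_op U \<longleftrightarrow>
    bounded_clinear U \<and> (\<forall>x y. cinner (U x) (U y) = cinner x y) \<and> surj U"

definition ker_op :: "('a::chilbert_space \<Rightarrow> 'b::chilbert_space) \<Rightarrow> 'a set"
  where "ker_op T = {x. T x = 0}"

definition graph_op :: "('a::chilbert_space \<Rightarrow> 'b::chilbert_space) \<Rightarrow> ('a \<times> 'b) set"
  where "graph_op T = {(x, T x) |x. True}"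

definition unitarily_equivalent :: "'a::chilbert_space set \<Rightarrow> 'a set \<Rightarrow> bool"
  where "unitarily_equivalent R S \<longleftrightarrow> (\<exists>U. unitary_op U \<and> S = U ` R)"

section \<open>Systems of subspaces and Hilbert representations\<close>

text \<open>
  A system \<open>(H; E\<^sub>1, \<dots>, E\<^sub>n)\<close> is the list of its subspaces; the space \<open>H\<close> is
  their ambient type.
\<close>

definition subspace_system :: "'a::chilbert_space set list \<Rightarrow> bool"
  where "subspace_system Es \<longleftrightarrow> (\<forall>E\<in>set Es. csubspace E \<and> closed E)"

definition boundedly_isomorphic_systems ::
    "'a::chilbert_space set list \<Rightarrow> 'b::chilbert_space set list \<Rightarrow> bool"
  where "boundedly_isomorphic_systems Es Fs \<longleftrightarrow>
    subspace_system Es \<and> subspace_system Fs \<and> length Es = length Fs \<and>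
    (\<exists>\<phi>. invertible_op \<phi> \<and> (\<forall>i<length Es. \<phi> ` (Es ! i) = Fs ! i))"

definition derived_system :: "'a::chilbert_space set \<Rightarrow> 'a set \<Rightarrow> 'a set list"
  where "derived_system E1 E2 = [E1, orth_compl E1, E2]"

lemma orth_compl_fst_summand:
  "orth_compl (UNIV \<times> {0} :: ('a::chilbert_space \<times> 'b::chilbert_space) set) = {0} \<times> UNIV"
proof -
  have zero: "cinner x 0 = 0" for x :: "'c::chilbert_space"
  proof -
    have "cinner (0 + 0) x = cinner 0 x + cinner 0 x"
      by (rule cinner_add_left)
    then show ?thesis
      using cinner_commute[of x 0] by simp
  qed
  have "cinner x x = 0 \<longleftrightarrow> x = 0" for x :: 'a
    by (simp add: cinner_self)
  moreover have "cinner 0 x = 0" for x :: 'a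
    using cinner_commute[of 0 x] by (simp add: zero)
  ultimately have "(\<forall>y. cinner x y = 0) \<longleftrightarrow> x = 0" for x :: 'a
    by metis
  then show ?thesis
    by (auto simp: orth_compl_def cinner_prod_def zero)
qed

lemma derived_system_graph:
  "derived_system (UNIV \<times> {0}) (graph_op T) = [UNIV \<times> {0}, {0} \<times> UNIV, graph_op T]"
  by (simp add: derived_system_def orth_compl_fst_summand)

text \<open>
  A Hilbert representation of the quiver \<open>1 \<rightarrow> 2\<close> is a bounded operator, the Hilbert spaces at
  the vertices being its domain and codomain types; the representation constructed by an
  operator is therefore that operator itself.
\<close>

definition A2_representation :: "('a::chilbert_space \<Rightarrow> 'b::chilbert_space) \<Rightarrow> bool"
  where "A2_representation f \<longleftrightarrow> bounded_clinear f"

definition boundedly_isomorphic_representations ::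
    "('a::chilbert_space \<Rightarrow> 'b::chilbert_space) \<Rightarrow> ('c::chilbert_space \<Rightarrow> 'd::chilbert_space) \<Rightarrow> bool"
  where "boundedly_isomorphic_representations f g \<longleftrightarrow>
    A2_representation f \<and> A2_representation g \<and>
    (\<exists>\<phi>1 \<phi>2. invertible_op \<phi>1 \<and> invertible_op \<phi>2 \<and> \<phi>2 \<circ> f = g \<circ> \<phi>1)"

definition all_equivalent :: "bool list \<Rightarrow> bool"
  where "all_equivalent ps \<longleftrightarrow> (\<forall>p\<in>set ps. \<forall>q\<in>set ps. p \<longleftrightarrow> q)"

end

theory Submission
  imports Defs
begin

text \<open>
  All conditions are compared with the factorization \<open>T = L T' M\<close>. That it is the same as an
  isomorphism of representations is a matter of moving \<open>L\<close> to the other side. It yields the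
  diagonal isomorphism \<open>M \<oplus> L\<inverse>\<close> of three subspace systems, which is also one of the two subspace
  systems. Conversely an isomorphism of the two subspace systems is a triangular operator matrix,
  and its action on the second space and on the graphs gives back \<open>L\<close> and \<open>M\<close>
  (\<open>intertwining_of_two_subspace_isomorphism\<close>).

  The analytic content is the equivalence with the condition on ranges and kernels. If \<open>T = L T' M\<close>,
  the kernels are isomorphic under \<open>M\<close> and have the same dimension, because a bounded operator
  cannot map a closed subspace onto one of larger dimension (\<open>card_basis_image_le\<close>). The ranges satisfy
  \<open>range T = L ` range T'\<close> with \<open>L\<close> only invertible, and the main step is to replace \<open>L\<close> by a unitary
  operator (\<open>unitarily_equivalent_range_invertible_compose\<close>). For an operator \<open>S\<close>, the polar
  decomposition identifies \<open>range S\<close> isometrically with the range of the modulus of \<open>S\<close>, and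
  the range of a selfadjoint \<open>R\<close> depends on the seminorm \<open>\<lambda>x. norm (R x)\<close> up to equivalence only
  (\<open>range_subset_of_norm_le\<close>). As the moduli of \<open>S\<close> and \<open>L S\<close> define equivalent seminorms, their
  ranges coincide, and this identifies \<open>range S\<close> isometrically with \<open>range (L S)\<close>. The orthogonal complements
  of the ranges are matched in the same way.

  Conversely, if a unitary \<open>U\<close> maps \<open>range T\<close> onto \<open>range T'\<close>, then \<open>T' y = U (T x)\<close> can be solved
  uniquely for \<open>y\<close> orthogonal to the kernel of \<open>T'\<close>, boundedly in \<open>x\<close> by the closed graph theorem
  (\<open>range_inclusion_factorization\<close>). Adding an isometry between the kernels, available because their
  dimensions agree (\<open>isometries_of_hilbert_dim_eq\<close>), gives an invertible \<open>M\<close> with \<open>T' M = U T\<close>.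

  The required operators are obtained from linear relations in a direct sum on which the norm of the
  second component is controlled by that of the first (\<open>operator_of_bounded_relation\<close>), and the
  moduli from a norm-convergent iteration for square roots (\<open>selfadjoint_quadratic_equation\<close>).
\<close>

section \<open>Complex inner products and closed subspaces\<close>

instance chilbert_space \<subseteq> banach ..

interpretation cspace: vector_space "scaleC :: complex \<Rightarrow> 'a::chilbert_space \<Rightarrow> 'a"
proof
  fix x :: 'a
  show "1 *\<^sub>C x = x"
    using scaleC_of_real[of 1 x] by simp
qed (simp_all add: scaleC_add_right scaleC_add_left scaleC_scaleC)

lemma csubspace_iff_subspace: "csubspace = cspace.subspace"
  by (auto simp: fun_eq_iff csubspace_def cspace.subspace_def)

lemma cinner_add_right: "cinner x (y + z) = cinner x y + cinner x z"
  by (metis cinner_add_left cinner_commute complex_cnj_add)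

lemma cinner_scaleC_right: "cinner x (a *\<^sub>C y) = cnj a * cinner x y"
  by (metis cinner_commute cinner_scaleC_left complex_cnj_mult)

lemma cinner_zero_left [simp]: "cinner 0 y = 0"
  using cinner_add_left[of 0 0 y] by simp

lemma cinner_zero_right [simp]: "cinner x 0 = 0"
  using cinner_add_right[of x 0 0] by simp

lemma cinner_diff_left: "cinner (x - y) z = cinner x z - cinner y z"
  using cinner_add_left[of "x - y" y z] by simp

lemma cinner_diff_right: "cinner x (y - z) = cinner x y - cinner x z"
  using cinner_add_right[of x "y - z" z] by simp

lemma cinner_scaleR_left: "cinner (r *\<^sub>R x) y = r * cinner x y"
  by (metis cinner_scaleC_left scaleC_of_real)

lemma cinner_scaleR_right: "cinner x (r *\<^sub>R y) = r * cinner x y"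
  by (metis cinner_scaleC_right scaleC_of_real complex_cnj_complex_of_real)

lemma cinner_eq_zero_commute: "cinner x y = 0 \<longleftrightarrow> cinner y x = 0"
  by (metis cinner_commute complex_cnj_zero)

lemma cinner_self_eq_zero [simp]: "cinner x x = 0 \<longleftrightarrow> x = 0"
  by (simp add: cinner_self)

lemma cinner_extensionality:
  assumes "\<And>z. cinner x z = cinner y z"
  shows "x = y"
proof -
  have "cinner (x - y) (x - y) = 0"
    using assms by (simp add: cinner_diff_left)
  then show ?thesis by simp
qed

text \<open>
  The imaginary part of the complex inner product is a real inner product with \<open>\<i> *\<^sub>C y\<close>,
  so that continuity and linearity can be read off from the real structure.
\<close>

lemma cinner_eq_inner: "cinner x y = Complex (inner x y) (inner x (\<i> *\<^sub>C y))"
proof -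
  have "Re (cinner x (\<i> *\<^sub>C y)) = Im (cinner x y)"
    by (simp add: cinner_scaleC_right)
  then show ?thesis
    by (simp add: complex_eq_iff Re_cinner)
qed

lemma norm_scaleC: "norm (a *\<^sub>C x) = norm a * norm x"
proof -
  have "complex_of_real ((norm (a *\<^sub>C x))\<^sup>2) = a * (cnj a * complex_of_real ((norm x)\<^sup>2))"
    by (simp only: cinner_self[symmetric] cinner_scaleC_left cinner_scaleC_right mult_ac)
  also have "\<dots> = complex_of_real ((norm a * norm x)\<^sup>2)"
    using complex_norm_square[of a] by (simp add: power_mult_distrib)
  finally have "(norm (a *\<^sub>C x))\<^sup>2 = (norm a * norm x)\<^sup>2"
    using of_real_eq_iff by blast
  then show ?thesis
    by (simp add: power2_eq_iff_nonneg)
qed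

lemma scaleC_scaleR_commute: "a *\<^sub>C r *\<^sub>R x = r *\<^sub>R a *\<^sub>C x"
  by (simp add: scaleC_of_real[symmetric] scaleC_scaleC mult.commute)

lemma bounded_linear_scaleC: "bounded_linear ((*\<^sub>C) a)"
  by (rule bounded_linear_intro[of _ "norm a"])
    (simp_all add: scaleC_add_right scaleC_scaleR_commute norm_scaleC mult.commute)

lemmas tendsto_scaleC [tendsto_intros] = bounded_linear.tendsto[OF bounded_linear_scaleC]

lemma tendsto_cinner [tendsto_intros]:
  assumes "(f \<longlongrightarrow> x) F" and "(g \<longlongrightarrow> y) F"
  shows "((\<lambda>n. cinner (f n) (g n)) \<longlongrightarrow> cinner x y) F"
  unfolding cinner_eq_inner using assms by (intro tendsto_intros)

lemma continuous_on_cinner [continuous_intros]: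
  assumes "continuous_on S f" and "continuous_on S g"
  shows "continuous_on S (\<lambda>x. cinner (f x) (g x))"
  using assms unfolding continuous_on_def by (blast intro: tendsto_cinner)

lemma pythagoras_cinner:
  assumes "cinner x y = 0"
  shows "(norm (x + y))\<^sup>2 = (norm x)\<^sup>2 + (norm y)\<^sup>2"
proof -
  have "inner x y = 0"
    using assms by (simp add: Re_cinner[symmetric])
  then show ?thesis
    by (simp add: power2_norm_eq_inner inner_add_left inner_add_right inner_commute)
qed

lemma csubspace_0: "csubspace S \<Longrightarrow> 0 \<in> S"
  and csubspace_add: "csubspace S \<Longrightarrow> x \<in> S \<Longrightarrow> y \<in> S \<Longrightarrow> x + y \<in> S"
  and csubspace_scaleC: "csubspace S \<Longrightarrow> x \<in> S \<Longrightarrow> a *\<^sub>C x \<in> S"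
  by (auto simp: csubspace_def)

lemma csubspace_scaleR: "csubspace S \<Longrightarrow> x \<in> S \<Longrightarrow> r *\<^sub>R x \<in> S"
  by (metis csubspace_scaleC scaleC_of_real)

lemma csubspace_diff: "csubspace S \<Longrightarrow> x \<in> S \<Longrightarrow> y \<in> S \<Longrightarrow> x - y \<in> S"
  by (simp add: csubspace_iff_subspace cspace.subspace_diff)

lemma csubspace_UNIV: "csubspace UNIV"
  by (simp add: csubspace_def)

lemma csubspace_hull: "csubspace (csubspace hull S)"
  unfolding csubspace_iff_subspace by (rule cspace.subspace_span[unfolded cspace.span_def])

lemma csubspace_closure:
  assumes "csubspace S"
  shows "csubspace (closure S)"
  unfolding csubspace_def
proof (intro conjI ballI allI)
  show "0 \<in> closure S"
    using assms closure_subset csubspace_0 by blast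
  fix x assume "x \<in> closure S"
  then obtain f where f: "\<And>n. f n \<in> S" "f \<longlonglongrightarrow> x"
    using closure_sequential by blast
  show "a *\<^sub>C x \<in> closure S" for a
    unfolding closure_sequential
    using f assms by (intro exI[of _ "\<lambda>n. a *\<^sub>C f n"]) (auto intro: csubspace_scaleC tendsto_intros)
  fix y assume "y \<in> closure S"
  then obtain g where g: "\<And>n. g n \<in> S" "g \<longlonglongrightarrow> y"
    using closure_sequential by blast
  show "x + y \<in> closure S"
    unfolding closure_sequential
    using f g assms by (intro exI[of _ "\<lambda>n. f n + g n"]) (auto intro: csubspace_add tendsto_intros)
qed

text \<open>
  The closed linear span is the least closed subspace above a set. Applied to the set of vectors
  with some property, this is an induction principle for closed spans.
\<close>

lemma closure_hull_subset:
  assumes "B \<subseteq> N" and "csubspace N" and "closed N"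
  shows "closure (csubspace hull B) \<subseteq> N"
  using assms by (meson closure_minimal hull_minimal)

lemma csubspace_orth_compl: "csubspace (orth_compl S)"
  by (auto simp: csubspace_def orth_compl_def cinner_add_left cinner_scaleC_left)

lemma closed_orth_compl: "closed (orth_compl S)"
proof -
  have "orth_compl S = (\<Inter>y\<in>S. {x. cinner x y = 0})"
    by (auto simp: orth_compl_def)
  moreover have "closed {x. cinner x y = 0}" for y :: 'a
    by (intro closed_Collect_eq continuous_intros)
  ultimately show ?thesis by auto
qed

lemma orth_compl_closure: "orth_compl (closure S) = orth_compl S"
proof
  show "orth_compl (closure S) \<subseteq> orth_compl S"
    using closure_subset by (auto simp: orth_compl_def)
  show "orth_compl S \<subseteq> orth_compl (closure S)"
  proof
    fix x assume "x \<in> orth_compl S"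
    then have "S \<subseteq> {y. cinner x y = 0}"
      by (auto simp: orth_compl_def)
    moreover have "closed {y. cinner x y = 0}"
      by (intro closed_Collect_eq continuous_intros)
    ultimately have "closure S \<subseteq> {y. cinner x y = 0}"
      by (rule closure_minimal)
    then show "x \<in> orth_compl (closure S)"
      by (auto simp: orth_compl_def)
  qed
qed

section \<open>Bounded complex-linear operators\<close>

lemma bounded_clinear_bounded_linear: "bounded_clinear T \<Longrightarrow> bounded_linear T"
  and bounded_clinear_scaleC: "bounded_clinear T \<Longrightarrow> T (a *\<^sub>C x) = a *\<^sub>C T x"
  by (simp_all add: bounded_clinear_def)

lemma bounded_clinear_add: "bounded_clinear T \<Longrightarrow> T (x + y) = T x + T y"
  and bounded_clinear_diff: "bounded_clinear T \<Longrightarrow> T (x - y) = T x - T y"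
  and bounded_clinear_0: "bounded_clinear T \<Longrightarrow> T 0 = 0"
  by (simp_all add: bounded_clinear_def linear_add linear_diff linear_0 bounded_linear.linear)

lemma bounded_clinear_pos_bound:
  assumes "bounded_clinear T"
  obtains c where "c > 0" and "\<And>x. norm (T x) \<le> c * norm x"
  using bounded_linear.pos_bounded[OF bounded_clinear_bounded_linear[OF assms]]
  by (metis mult.commute)

lemma bounded_clinearI:
  assumes "\<And>x y. T (x + y) = T x + T y" and "\<And>a x. T (a *\<^sub>C x) = a *\<^sub>C T x"
    and "\<And>x. norm (T x) \<le> c * norm x"
  shows "bounded_clinear T"
  unfolding bounded_clinear_def
proof (intro conjI allI)
  show "bounded_linear T"
    using assms by (intro bounded_linear_intro[of _ c])
      (auto simp: scaleC_of_real[symmetric] mult.commute)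
qed (rule assms(2))

lemma bounded_clinear_compose:
  "bounded_clinear S \<Longrightarrow> bounded_clinear T \<Longrightarrow> bounded_clinear (\<lambda>x. S (T x))"
  by (simp add: bounded_clinear_def bounded_linear_compose)

lemma bounded_clinear_id: "bounded_clinear (\<lambda>x. x)"
  and bounded_clinear_zero: "bounded_clinear (\<lambda>x. 0)"
  by (simp_all add: bounded_clinear_def bounded_linear_ident bounded_linear_zero)

lemma bounded_clinear_plus:
  "bounded_clinear S \<Longrightarrow> bounded_clinear T \<Longrightarrow> bounded_clinear (\<lambda>x. S x + T x)"
  by (simp add: bounded_clinear_def bounded_linear_add scaleC_add_right)

lemma bounded_clinear_fst: "bounded_clinear fst"
  and bounded_clinear_snd: "bounded_clinear snd"
  by (simp_all add: bounded_clinear_def bounded_linear_fst bounded_linear_snd scaleC_prod_def)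

lemma bounded_clinear_Pair:
  "bounded_clinear S \<Longrightarrow> bounded_clinear T \<Longrightarrow> bounded_clinear (\<lambda>x. (S x, T x))"
  by (simp add: bounded_clinear_def bounded_linear_Pair scaleC_prod_def)

lemma bounded_clinear_minus:
  "bounded_clinear S \<Longrightarrow> bounded_clinear T \<Longrightarrow> bounded_clinear (\<lambda>x. S x - T x)"
  by (simp add: bounded_clinear_def bounded_linear_sub cspace.scale_right_diff_distrib)

lemma bounded_clinear_cinner_left: "bounded_clinear (\<lambda>x. cinner x y)"
proof -
  have "bounded_linear (\<lambda>x. cinner x y)"
    unfolding cinner_eq_inner Complex_eq
    by (intro bounded_linear_add bounded_linear_const_mult bounded_linear_inner_left
        bounded_linear_of_real[THEN bounded_linear_compose])
  then show ?thesis
    by (simp add: bounded_clinear_def cinner_scaleC_left scaleC_complex_def)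
qed

lemma bounded_clinear_scaleC_const:
  assumes "bounded_clinear f"
  shows "bounded_clinear (\<lambda>x. f x *\<^sub>C b)"
proof -
  obtain c where c: "c > 0" "\<And>x. norm (f x) \<le> c * norm x"
    using bounded_clinear_pos_bound[OF assms] by blast
  show ?thesis
  proof (rule bounded_clinearI)
    show "norm (f x *\<^sub>C b) \<le> (c * norm b) * norm x" for x
      using mult_right_mono[OF c(2)[of x] norm_ge_zero[of b]] by (simp add: norm_scaleC mult_ac)
  qed (simp_all add: bounded_clinear_add[OF assms] bounded_clinear_scaleC[OF assms]
      scaleC_add_left scaleC_complex_def scaleC_scaleC)
qed

lemma bounded_clinear_sum:
  assumes "\<And>i. i \<in> I \<Longrightarrow> bounded_clinear (f i)"
  shows "bounded_clinear (\<lambda>x. \<Sum>i\<in>I. f i x)"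
  using assms by (induction I rule: infinite_finite_induct)
    (simp_all add: bounded_clinear_zero bounded_clinear_plus)

lemma csubspace_image:
  assumes T: "bounded_clinear T" and S: "csubspace S"
  shows "csubspace (T ` S)"
  unfolding csubspace_def
proof (intro conjI ballI allI)
  show "0 \<in> T ` S"
    using bounded_clinear_0[OF T] csubspace_0[OF S] by (metis imageI)
  show "x + y \<in> T ` S" if "x \<in> T ` S" "y \<in> T ` S" for x y
    using that csubspace_add[OF S] by (auto simp: bounded_clinear_add[OF T, symmetric])
  show "a *\<^sub>C x \<in> T ` S" if "x \<in> T ` S" for a x
    using that csubspace_scaleC[OF S] by (auto simp: bounded_clinear_scaleC[OF T, symmetric])
qed

lemma csubspace_vimage:
  "bounded_clinear T \<Longrightarrow> csubspace S \<Longrightarrow> csubspace (T -` S)"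
  unfolding csubspace_def
  by (simp add: bounded_clinear_0 bounded_clinear_add bounded_clinear_scaleC)

lemma closed_vimage_bounded_clinear:
  "bounded_clinear T \<Longrightarrow> closed S \<Longrightarrow> closed (T -` S)"
  by (intro closed_vimage linear_continuous_on bounded_clinear_bounded_linear)

lemma csubspace_ker: "bounded_clinear T \<Longrightarrow> csubspace (ker_op T)"
  using csubspace_vimage[of T "{0}"] by (simp add: ker_op_def vimage_def csubspace_def)

lemma closed_ker: "bounded_clinear T \<Longrightarrow> closed (ker_op T)"
  using closed_vimage_bounded_clinear[of T "{0}"] by (simp add: ker_op_def vimage_def)

section \<open>Orthogonal projections and adjoints\<close>

text \<open>
  By the parallelogram law the points of \<open>N\<close> that are almost nearest to \<open>x\<close> form closed
  sets whose diameters shrink to zero, so completeness yields a nearest point. If the difference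
  were not orthogonal to some \<open>y\<close> in \<open>N\<close>, moving in the direction of \<open>y\<close> would come closer.
\<close>

lemma orthogonal_projection_exists:
  assumes "csubspace N" and "closed N"
  shows "\<exists>p\<in>N. x - p \<in> orth_compl N"
proof -
  define d where "d = (INF y\<in>N. (norm (x - y))\<^sup>2)"
  have bdd: "bdd_below ((\<lambda>y. (norm (x - y))\<^sup>2) ` N)"
    by (rule bdd_belowI[of _ 0]) auto
  have d_le: "d \<le> (norm (x - y))\<^sup>2" if "y \<in> N" for y
    unfolding d_def using that bdd by (rule cINF_lower[rotated])
  define S where "S n = {y\<in>N. (norm (x - y))\<^sup>2 \<le> d + 1 / real (Suc n)}" for n
  have near: "(norm (y - z))\<^sup>2 \<le> 4 / real (Suc n)" if "y \<in> S n" "z \<in> S n" for y z n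
  proof -
    have m: "(1/2) *\<^sub>R (y + z) \<in> N"
      using that assms(1) by (auto simp: S_def intro: csubspace_scaleR csubspace_add)
    have "(norm (y - z))\<^sup>2
        = 2 * (norm (x - y))\<^sup>2 + 2 * (norm (x - z))\<^sup>2 - 4 * (norm (x - (1/2) *\<^sub>R (y + z)))\<^sup>2"
      by (simp add: power2_norm_eq_inner inner_diff_left inner_diff_right inner_add_left
          inner_add_right inner_commute algebra_simps)
    also have "\<dots> \<le> 2 * (d + 1 / real (Suc n)) + 2 * (d + 1 / real (Suc n)) - 4 * d"
      using that d_le[OF m] by (simp add: S_def)
    finally show ?thesis by simp
  qed
  obtain p where p: "\<And>n. p \<in> S n"
  proof (rule decreasing_closed_nest[of S])
    show "closed (S n)" for n
      unfolding S_def Collect_conj_eq Collect_mem_eq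
      by (intro closed_Int assms closed_Collect_le continuous_intros)
    show "S n \<noteq> {}" for n
    proof -
      have "\<exists>y\<in>N. (norm (x - y))\<^sup>2 < d + 1 / real (Suc n)"
        unfolding d_def using csubspace_0[OF assms(1)] bdd
        by (subst cINF_less_iff[symmetric]) auto
      then show ?thesis
        by (auto simp: S_def intro: less_imp_le)
    qed
    show "S n \<subseteq> S m" if "m \<le> n" for m n
    proof -
      have "1 / real (Suc n) \<le> 1 / real (Suc m)"
        using that by (simp add: frac_le)
      then show ?thesis
        unfolding S_def by auto
    qed
    show "\<exists>n. \<forall>y\<in>S n. \<forall>z\<in>S n. dist y z < e" if "e > 0" for e
    proof -
      obtain n where n: "4 / e\<^sup>2 < real (Suc n)"
        using reals_Archimedean2 less_trans[OF _ lessI[THEN of_nat_less_iff[THEN iffD2]]] by blast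
      have "dist y z < e" if "y \<in> S n" "z \<in> S n" for y z
      proof (rule power2_less_imp_less)
        have "(dist y z)\<^sup>2 \<le> 4 / real (Suc n)"
          using near[OF that] by (simp add: dist_norm)
        also have "\<dots> < e\<^sup>2"
          using n \<open>e > 0\<close> by (simp add: field_simps)
        finally show "(dist y z)\<^sup>2 < e\<^sup>2" .
      qed (use \<open>e > 0\<close> in simp)
      then show ?thesis by blast
    qed
  qed (use that in blast)
  have pN: "p \<in> N"
    using p[of 0] by (simp add: S_def)
  have p_le: "(norm (x - p))\<^sup>2 \<le> (norm (x - y))\<^sup>2" if "y \<in> N" for y
  proof -
    have "(norm (x - p))\<^sup>2 \<le> d"
    proof (rule LIMSEQ_le_const)
      show "(\<lambda>n. d + 1 / real (Suc n)) \<longlonglongrightarrow> d"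
        using tendsto_add[OF tendsto_const[of d] LIMSEQ_inverse_real_of_nat] by (simp add: inverse_eq_divide)
      show "\<exists>N. \<forall>n\<ge>N. (norm (x - p))\<^sup>2 \<le> d + 1 / real (Suc n)"
        using p by (auto simp: S_def)
    qed
    then show ?thesis
      using d_le[OF that] by linarith
  qed
  have "cinner (x - p) y = 0" if "y \<in> N" for y
  proof (cases "y = 0")
    case False
    define c where "c = cinner (x - p) y"
    define t where "t = 1 / (norm y)\<^sup>2"
    \<comment> \<open>\<open>v\<close> is the component of \<open>x - p\<close> along \<open>y\<close>, the most profitable correction.\<close>
    define v where "v = (complex_of_real t * c) *\<^sub>C y"
    have "inner (x - p) v = t * (norm c)\<^sup>2"
      unfolding v_def Re_cinner[symmetric] cinner_scaleC_right c_def[symmetric] cmod_power2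
      by (simp add: power2_eq_square algebra_simps)
    moreover have "(norm v)\<^sup>2 = t * (norm c)\<^sup>2"
      unfolding v_def norm_scaleC norm_mult norm_of_real
      using False by (simp add: t_def power_mult_distrib power2_eq_square)
    moreover have "(norm (x - p))\<^sup>2 \<le> (norm (x - (p + v)))\<^sup>2"
      unfolding v_def using assms(1) pN that by (intro p_le csubspace_add csubspace_scaleC)
    moreover have "(norm (x - (p + v)))\<^sup>2 = (norm (x - p))\<^sup>2 - 2 * inner (x - p) v + (norm v)\<^sup>2"
      by (simp add: power2_norm_eq_inner inner_diff_left inner_diff_right inner_add_left
          inner_add_right inner_commute algebra_simps)
    ultimately have "t * (norm c)\<^sup>2 \<le> 0"
      by simp
    then have "c = 0"
      using False by (simp add: t_def mult_le_0_iff divide_le_0_iff)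
    then show ?thesis
      by (simp add: c_def)
  qed simp
  then show ?thesis
    using pN by (auto simp: orth_compl_def)
qed

definition cproj :: "'a::chilbert_space set \<Rightarrow> 'a \<Rightarrow> 'a"
  where "cproj N x = (SOME p. p \<in> N \<and> x - p \<in> orth_compl N)"

context
  fixes N :: "'a::chilbert_space set"
  assumes N: "csubspace N" "closed N"
begin

lemma cproj_mem: "cproj N x \<in> N"
  and diff_cproj_mem: "x - cproj N x \<in> orth_compl N"
  unfolding cproj_def
  using someI_ex[OF orthogonal_projection_exists[OF N, unfolded Bex_def]] by blast+

lemma cproj_unique:
  assumes "p \<in> N" and "x - p \<in> orth_compl N"
  shows "cproj N x = p"
proof -
  have "cproj N x - p \<in> N"
    using cproj_mem assms(1) N(1) csubspace_diff by blast
  moreover have "(x - p) - (x - cproj N x) \<in> orth_compl N"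
    by (rule csubspace_diff[OF csubspace_orth_compl assms(2) diff_cproj_mem])
  ultimately have "cinner (cproj N x - p) (cproj N x - p) = 0"
    by (simp add: orth_compl_def)
  then show ?thesis by simp
qed

lemma cproj_ident: "x \<in> N \<Longrightarrow> cproj N x = x"
  by (rule cproj_unique) (simp_all add: csubspace_0[OF csubspace_orth_compl])

lemma cproj_eq_0: "x \<in> orth_compl N \<Longrightarrow> cproj N x = 0"
  by (rule cproj_unique) (simp_all add: csubspace_0[OF N(1)])

lemma norm_cproj_le: "norm (cproj N x) \<le> norm x"
proof -
  have "cinner (cproj N x) (x - cproj N x) = 0"
    using cproj_mem diff_cproj_mem by (subst cinner_eq_zero_commute) (simp add: orth_compl_def)
  then have "(norm x)\<^sup>2 = (norm (cproj N x))\<^sup>2 + (norm (x - cproj N x))\<^sup>2"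
    using pythagoras_cinner[of "cproj N x" "x - cproj N x"] by simp
  then have "(norm (cproj N x))\<^sup>2 \<le> (norm x)\<^sup>2"
    by simp
  then show ?thesis
    by (rule power2_le_imp_le) simp
qed

lemma bounded_clinear_cproj: "bounded_clinear (cproj N)"
proof (rule bounded_clinearI)
  show "cproj N (x + y) = cproj N x + cproj N y" for x y
    using csubspace_add[OF csubspace_orth_compl diff_cproj_mem diff_cproj_mem, of x y]
    by (intro cproj_unique csubspace_add N cproj_mem) (simp add: algebra_simps)
  show "cproj N (a *\<^sub>C x) = a *\<^sub>C cproj N x" for a x
    using csubspace_scaleC[OF csubspace_orth_compl diff_cproj_mem, of a x]
    by (intro cproj_unique csubspace_scaleC N cproj_mem)
      (simp add: cspace.scale_right_diff_distrib)
  show "norm (cproj N x) \<le> 1 * norm x" for x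
    by (simp add: norm_cproj_le)
qed

end

lemma closure_eq_UNIV_of_orth_compl:
  assumes "csubspace S" and "\<And>x. x \<in> orth_compl S \<Longrightarrow> x = 0"
  shows "closure S = UNIV"
proof -
  have "x - cproj (closure S) x = 0" for x
    using diff_cproj_mem[OF csubspace_closure[OF assms(1)] closed_closure, of x]
    by (intro assms(2)) (simp add: orth_compl_closure)
  then show ?thesis
    using cproj_mem[OF csubspace_closure[OF assms(1)] closed_closure] by (metis UNIV_eq_I eq_iff_diff_eq_0)
qed

text \<open>
  The kernel of a nonzero functional has codimension one, so the functional is the inner product
  with a multiple of a vector \<open>e\<close> orthogonal to the kernel.
\<close>

lemma riesz_representation:
  fixes f :: "'a::chilbert_space \<Rightarrow> complex"
  assumes "bounded_clinear f"
  shows "\<exists>z. \<forall>x. f x = cinner x z"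
proof (cases "\<forall>x. f x = 0")
  case True
  then show ?thesis by (intro exI[of _ 0]) simp
next
  case False
  then obtain u where u: "f u \<noteq> 0" by blast
  define e where "e = u - cproj (ker_op f) u"
  have ker: "csubspace (ker_op f)" "closed (ker_op f)"
    using assms by (rule csubspace_ker closed_ker)+
  have "cproj (ker_op f) u \<in> ker_op f"
    by (rule cproj_mem[OF ker])
  then have fe: "f e = f u"
    by (simp add: e_def bounded_clinear_diff[OF assms] ker_op_def)
  have e: "cinner y e = 0" if "f y = 0" for y
    using diff_cproj_mem[OF ker, of u] that
    by (subst cinner_eq_zero_commute) (simp add: e_def orth_compl_def ker_op_def)
  have ne: "cinner e e \<noteq> 0"
    using fe u bounded_clinear_0[OF assms] by auto
  have "f x = cinner x (cnj (f e / cinner e e) *\<^sub>C e)" for x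
  proof -
    have "f (x - (f x / f e) *\<^sub>C e) = 0"
      using u fe by (simp add: bounded_clinear_diff[OF assms] bounded_clinear_scaleC[OF assms]
          scaleC_complex_def)
    then have "cinner x e = (f x / f e) * cinner e e"
      using e by (metis cinner_diff_left cinner_scaleC_left eq_iff_diff_eq_0)
    then show ?thesis
      using ne u fe by (simp add: cinner_scaleC_right)
  qed
  then show ?thesis by blast
qed

text \<open>
  The adjoint comes from the Riesz representation of each functional
  \<open>\<lambda>x. cinner (T x) y\<close>; its additivity and homogeneity follow from uniqueness of the representing
  vector.
\<close>

lemma adjoint_exists:
  fixes T :: "'a::chilbert_space \<Rightarrow> 'b::chilbert_space"
  assumes "bounded_clinear T"
  obtains S where "bounded_clinear S" and "\<And>x y. cinner (T x) y = cinner x (S y)"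
proof -
  obtain c where c: "c > 0" "\<And>x. norm (T x) \<le> c * norm x"
    using bounded_clinear_pos_bound[OF assms] by blast
  have "\<exists>z. \<forall>x. cinner (T x) y = cinner x z" for y
    by (intro riesz_representation bounded_clinear_compose[OF bounded_clinear_cinner_left assms])
  then obtain S where S: "\<And>x y. cinner (T x) y = cinner x (S y)"
    by metis
  have "bounded_clinear S"
  proof (rule bounded_clinearI)
    show "S (x + y) = S x + S y" for x y
      by (rule cinner_extensionality, subst (1 2) cinner_commute)
        (simp add: cinner_add_right S[symmetric])
    show "S (a *\<^sub>C x) = a *\<^sub>C S x" for a x
      by (rule cinner_extensionality, subst (1 2) cinner_commute)
        (simp add: cinner_scaleC_right S[symmetric])
    show "norm (S y) \<le> c * norm y" for y
    proof (cases "S y = 0")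
      case False
      have "(norm (S y))\<^sup>2 = inner (T (S y)) y"
        by (simp add: Re_cinner[symmetric] S cinner_self)
      also have "\<dots> \<le> norm (T (S y)) * norm y"
        by (rule norm_cauchy_schwarz)
      also have "\<dots> \<le> c * norm (S y) * norm y"
        using c(2) by (simp add: mult_right_mono)
      finally show ?thesis
        using False by (simp add: power2_eq_square algebra_simps)
    qed (use c in simp)
  qed
  then show thesis
    using that S by blast
qed

section \<open>Operators from norm-controlled relations\<close>

text \<open>
  A linear relation whose second component is controlled in norm by the first is the graph of a
  bounded operator on its domain. By completeness this operator extends to the closure of the domain,
  with graph the closure of the relation, and composing with the projection makes it total. The
  operators needed below are prescribed only on a dense set, or on vectors such as \<open>S x\<close> for which
  \<open>x\<close> is not unique; a relation expresses such prescriptions directly, without a separate argument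
  for well-definedness.
\<close>

lemma operator_of_bounded_relation:
  fixes G :: "('a::chilbert_space \<times> 'b::chilbert_space) set"
  assumes G: "csubspace G" and bound: "\<And>x y. (x, y) \<in> G \<Longrightarrow> norm y \<le> c * norm x"
  obtains D where "bounded_clinear D" and "\<And>x y. (x, y) \<in> closure G \<Longrightarrow> D x = y"
    and "\<And>x. x \<in> closure (fst ` G) \<Longrightarrow> (x, D x) \<in> closure G"
proof -
  define N where "N = closure (fst ` G)"
  have N: "csubspace N" "closed N"
    unfolding N_def by (auto intro: csubspace_closure csubspace_image bounded_clinear_fst G)
  have clG: "csubspace (closure G)"
    by (rule csubspace_closure[OF G])
  define k where "k = \<bar>c\<bar> + 1"
  have k: "k > 0"
    by (simp add: k_def)
  have "closure G \<subseteq> {p. norm (snd p) \<le> k * norm (fst p)}"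
  proof (rule closure_minimal)
    show "G \<subseteq> {p. norm (snd p) \<le> k * norm (fst p)}"
    proof clarify
      fix x y assume "(x, y) \<in> G"
      from bound[OF this] have "norm y \<le> c * norm x" .
      also have "\<dots> \<le> k * norm x"
        by (intro mult_right_mono) (simp_all add: k_def)
      finally show "norm (snd (x, y)) \<le> k * norm (fst (x, y))" by simp
    qed
    show "closed {p :: 'a \<times> 'b. norm (snd p) \<le> k * norm (fst p)}"
      by (intro closed_Collect_le continuous_intros)
  qed
  then have clbound: "norm y \<le> k * norm x" if "(x, y) \<in> closure G" for x y
    using that by fastforce
  have single: "y = y'" if "(x, y) \<in> closure G" "(x, y') \<in> closure G" for x y y'
    using clbound csubspace_diff[OF clG that] by fastforce
  have total: "\<exists>y. (x, y) \<in> closure G" if x: "x \<in> N" for x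
  proof -
    obtain f where f: "\<forall>n. f n \<in> fst ` G" "f \<longlonglongrightarrow> x"
      using x[unfolded N_def closure_sequential] by blast
    have "\<exists>y. (f n, y) \<in> G" for n
      using spec[OF f(1), of n] by auto
    then obtain g where g: "\<And>n. (f n, g n) \<in> G"
      by metis
    have "Cauchy g"
    proof (rule metric_CauchyI)
      fix e :: real assume "e > 0"
      then have "e / k > 0"
        using k by simp
      then obtain M where M: "\<And>m n. m \<ge> M \<Longrightarrow> n \<ge> M \<Longrightarrow> dist (f m) (f n) < e / k"
        using f(2) LIMSEQ_imp_Cauchy metric_CauchyD by metis
      have "dist (g m) (g n) < e" if "m \<ge> M" "n \<ge> M" for m n
      proof -
        have "(f m - f n, g m - g n) \<in> closure G"
          using csubspace_diff[OF G g g, of m n] closure_subset by auto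
        then have "dist (g m) (g n) \<le> k * dist (f m) (f n)"
          unfolding dist_norm by (rule clbound)
        also have "\<dots> < e"
          using M[OF that] k by (simp add: field_simps)
        finally show ?thesis .
      qed
      then show "\<exists>M. \<forall>m\<ge>M. \<forall>n\<ge>M. dist (g m) (g n) < e" by blast
    qed
    then obtain y where "g \<longlonglongrightarrow> y"
      using Cauchy_convergent_iff convergent_def by blast
    with f(2) have "(\<lambda>n. (f n, g n)) \<longlonglongrightarrow> (x, y)"
      by (rule tendsto_Pair)
    then have "(x, y) \<in> closure G"
      unfolding closure_sequential using g by (intro exI[of _ "\<lambda>n. (f n, g n)"]) simp
    then show ?thesis ..
  qed
  define D where "D x = (THE y. (cproj N x, y) \<in> closure G)" for x
  have D_mem: "(cproj N x, D x) \<in> closure G" for x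
    unfolding D_def by (rule theI'[OF ex_ex1I[OF total[OF cproj_mem[OF N]] single]])
  have D_eq: "D x = y" if "(cproj N x, y) \<in> closure G" for x y
    using single D_mem that by blast
  have in_N: "x \<in> N" if "(x, y) \<in> closure G" for x y
    using closure_bounded_linear_image_subset[OF bounded_linear_fst, of G] that
    unfolding N_def by force
  show thesis
  proof
    show "bounded_clinear D"
    proof (rule bounded_clinearI)
      show "D (x + y) = D x + D y" for x y
        using csubspace_add[OF clG D_mem D_mem, of x y]
        by (intro D_eq) (simp add: bounded_clinear_add[OF bounded_clinear_cproj[OF N]])
      show "D (a *\<^sub>C x) = a *\<^sub>C D x" for a x
        using csubspace_scaleC[OF clG D_mem, of a x]
        by (intro D_eq) (simp add: bounded_clinear_scaleC[OF bounded_clinear_cproj[OF N]]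
            scaleC_prod_def)
      show "norm (D x) \<le> k * norm x" for x
        using clbound[OF D_mem] norm_cproj_le[OF N, of x] k
        by (meson mult_left_mono order_trans less_imp_le)
    qed
    show "D x = y" if "(x, y) \<in> closure G" for x y
      using in_N[OF that] that by (intro D_eq) (simp add: cproj_ident[OF N])
    show "(x, D x) \<in> closure G" if "x \<in> closure (fst ` G)" for x
      using D_mem[of x] that by (simp add: cproj_ident[OF N] N_def[symmetric])
  qed
qed

text \<open>
  When the relation preserves norms, so does its converse, and the two resulting operators are
  inverse to each other between the closure of the domain and the closure of the range.
\<close>

lemma isometries_of_relation:
  fixes G :: "('a::chilbert_space \<times> 'b::chilbert_space) set"
  assumes G: "csubspace G" and iso: "\<And>x y. (x, y) \<in> G \<Longrightarrow> norm y = norm x"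
  obtains V W where "bounded_clinear V" and "bounded_clinear W"
    and "\<And>x y. (x, y) \<in> G \<Longrightarrow> V x = y"
    and "\<And>x. x \<in> closure (fst ` G) \<Longrightarrow>
      V x \<in> closure (snd ` G) \<and> W (V x) = x \<and> norm (V x) = norm x"
    and "\<And>y. y \<in> closure (snd ` G) \<Longrightarrow> W y \<in> closure (fst ` G) \<and> V (W y) = y"
proof -
  have sw: "bounded_clinear (\<lambda>p::'a \<times> 'b. (snd p, fst p))" "bounded_clinear (\<lambda>p::'b \<times> 'a. (snd p, fst p))"
    by (intro bounded_clinear_Pair bounded_clinear_fst bounded_clinear_snd)+
  define G' where "G' = (\<lambda>p. (snd p, fst p)) ` G"
  have G': "csubspace G'"
    unfolding G'_def by (rule csubspace_image[OF sw(1) G])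
  have fstG': "fst ` G' = snd ` G"
    by (force simp: G'_def)
  have cl1: "(y, x) \<in> closure G'" if "(x, y) \<in> closure G" for x y
    using closure_bounded_linear_image_subset[OF bounded_clinear_bounded_linear[OF sw(1)], of G] that
    unfolding G'_def by force
  have "G = (\<lambda>p. (snd p, fst p)) ` G'"
    by (force simp: G'_def)
  then have cl2: "(x, y) \<in> closure G" if "(y, x) \<in> closure G'" for x y
    using closure_bounded_linear_image_subset[OF bounded_clinear_bounded_linear[OF sw(2)], of G'] that
    by force
  have fst_in: "x \<in> closure (fst ` G)" and snd_in: "y \<in> closure (snd ` G)"
    if "(x, y) \<in> closure G" for x y
    using closure_bounded_linear_image_subset[OF bounded_linear_fst, of G]
      closure_bounded_linear_image_subset[OF bounded_linear_snd, of G] that by force+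
  have "closure G \<subseteq> {p. norm (snd p) = norm (fst p)}"
    using iso by (intro closure_minimal closed_Collect_eq continuous_intros) auto
  then have cliso: "norm y = norm x" if "(x, y) \<in> closure G" for x y
    using that by fastforce
  obtain V where V: "bounded_clinear V" "\<And>x y. (x, y) \<in> closure G \<Longrightarrow> V x = y"
      "\<And>x. x \<in> closure (fst ` G) \<Longrightarrow> (x, V x) \<in> closure G"
    by (rule operator_of_bounded_relation[OF G, of 1]) (simp_all add: iso)
  have iso': "norm y \<le> 1 * norm x" if "(x, y) \<in> G'" for x y
    using that iso by (auto simp: G'_def)
  obtain W where W: "bounded_clinear W" "\<And>x y. (x, y) \<in> closure G' \<Longrightarrow> W x = y"
      "\<And>x. x \<in> closure (fst ` G') \<Longrightarrow> (x, W x) \<in> closure G'"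
    using operator_of_bounded_relation[OF G' iso'] by blast
  show thesis
  proof (rule that[OF V(1) W(1)])
    show "V x = y" if "(x, y) \<in> G" for x y
      using that V(2) closure_subset by blast
    show "V x \<in> closure (snd ` G) \<and> W (V x) = x \<and> norm (V x) = norm x"
      if "x \<in> closure (fst ` G)" for x
      using V(3)[OF that] snd_in cl1 W(2) cliso by blast
    show "W y \<in> closure (fst ` G) \<and> V (W y) = y" if "y \<in> closure (snd ` G)" for y
      using W(3)[unfolded fstG', OF that] fst_in cl2 V(2) by blast
  qed
qed

lemma cinner_preserved_of_norm_preserved:
  assumes "bounded_clinear U" and "\<And>x. norm (U x) = norm x"
  shows "cinner (U x) (U y) = cinner x y"
proof -
  have "inner (U x) (U y) = inner x y" for x y
    unfolding dot_norm bounded_clinear_add[OF assms(1), symmetric] assms(2) ..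
  then show ?thesis
    by (simp add: cinner_eq_inner bounded_clinear_scaleC[OF assms(1), symmetric])
qed

lemma unitary_of_isometric_relation:
  fixes G :: "('a::chilbert_space \<times> 'a) set"
  assumes "csubspace G" and "\<And>x y. (x, y) \<in> G \<Longrightarrow> norm y = norm x"
    and "closure (fst ` G) = UNIV" and "closure (snd ` G) = UNIV"
  obtains U where "unitary_op U" and "\<And>x y. (x, y) \<in> G \<Longrightarrow> U x = y"
proof -
  obtain U W where U: "bounded_clinear U" "\<And>x y. (x, y) \<in> G \<Longrightarrow> U x = y"
      "\<And>x. norm (U x) = norm x" "\<And>y. U (W y) = y"
    using isometries_of_relation[OF assms(1,2)] unfolding assms(3,4) by (metis UNIV_I)
  have "unitary_op U"
    unfolding unitary_op_def
    using U(1,4) cinner_preserved_of_norm_preserved[OF U(1,3)] by (metis surj_def)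
  then show thesis
    using that U(2) by blast
qed

section \<open>Square roots and the modulus of an operator\<close>

text \<open>
  If \<open>2 Y = A + Y\<^sup>2\<close>, then \<open>1 - Y\<close> is a square root of \<open>1 - A\<close>. The iteration
  \<open>Y \<mapsto> (A + Y\<^sup>2) / 2\<close>, started at zero, is dominated by the same iteration \<open>y \<mapsto> (1 + y\<^sup>2) / 2\<close>
  for the number one in place of \<open>A\<close>: the increments of \<open>Y\<close> are bounded in norm by those of \<open>y\<close>.
  The latter sequence is increasing and bounded by one, hence the former converges in operator norm
  even when \<open>norm A = 1\<close>. Complex linearity and symmetry pass from the iterates to the limit.
\<close>

lemma selfadjoint_quadratic_equation:
  fixes A :: "'a::chilbert_space \<Rightarrow>\<^sub>L 'a"
  assumes norm_A: "norm A \<le> 1"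
    and clin: "\<And>a x. A (a *\<^sub>C x) = a *\<^sub>C A x"
    and sym: "\<And>x y. cinner (A x) y = cinner x (A y)"
  obtains Y :: "'a \<Rightarrow>\<^sub>L 'a" where "2 *\<^sub>R Y = A + (Y o\<^sub>L Y)"
    and "\<And>a x. Y (a *\<^sub>C x) = a *\<^sub>C Y x"
    and "\<And>x y. cinner (Y x) y = cinner x (Y y)"
proof -
  define Y where "Y = rec_nat (0 :: 'a \<Rightarrow>\<^sub>L 'a) (\<lambda>_ Z. (1/2) *\<^sub>R (A + (Z o\<^sub>L Z)))"
  define y where "y = rec_nat (0 :: real) (\<lambda>_ z. (1 + z\<^sup>2) / 2)"
  have Y_0: "Y 0 = 0" and Y_Suc: "Y (Suc n) = (1/2) *\<^sub>R (A + (Y n o\<^sub>L Y n))" for n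
    by (simp_all add: Y_def)
  have y_0: "y 0 = 0" and y_Suc: "y (Suc n) = (1 + (y n)\<^sup>2) / 2" for n
    by (simp_all add: y_def)
  have y_bounds: "0 \<le> y n \<and> y n \<le> 1" for n
    by (induction n) (auto simp: y_0 y_Suc power_le_one)
  have y_mono: "y n \<le> y (Suc n)" for n
    using zero_le_power2[of "y n - 1"] by (simp add: y_Suc power2_diff)
  have "convergent y"
    using y_bounds y_mono by (intro Bseq_mono_convergent BseqI'[of _ 1])
      (auto intro: lift_Suc_mono_le)
  then obtain l where "y \<longlonglongrightarrow> l"
    by (auto simp: convergent_def)
  then have summ_y: "summable (\<lambda>n. y (Suc n) - y n)"
    by (rule telescope_summable)
  have Y_norm: "norm (Y n) \<le> y n" for n
  proof (induction n)
    case (Suc n)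
    have "norm (Y n o\<^sub>L Y n) \<le> (y n)\<^sup>2"
      using norm_blinfun_compose[of "Y n" "Y n"] mult_mono[OF Suc Suc] y_bounds[of n]
      by (simp add: power2_eq_square)
    then show ?case
      using norm_triangle_ineq[of A "Y n o\<^sub>L Y n"] norm_A by (simp add: Y_Suc y_Suc)
  qed (simp add: Y_0 y_0)
  have Y_step: "norm (Y (Suc n) - Y n) \<le> y (Suc n) - y n" for n
  proof (induction n)
    case 0
    show ?case
      using norm_A by (simp add: Y_Suc Y_0 y_0 y_Suc)
  next
    case (Suc n)
    define E where "E = Y (Suc n) - Y n"
    have "Y (Suc (Suc n)) - Y (Suc n)
        = (1/2) *\<^sub>R ((Y (Suc n) o\<^sub>L Y (Suc n)) - (Y n o\<^sub>L Y n))"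
      unfolding Y_Suc[of "Suc n"] Y_Suc[of n] by (simp add: algebra_simps)
    also have "(Y (Suc n) o\<^sub>L Y (Suc n)) - (Y n o\<^sub>L Y n) = (Y (Suc n) o\<^sub>L E) + (E o\<^sub>L Y n)"
      unfolding E_def by (rule blinfun_eqI)
        (simp add: blinfun.add_left blinfun.diff_left blinfun.diff_right)
    finally have "norm (Y (Suc (Suc n)) - Y (Suc n))
        = (1/2) * norm ((Y (Suc n) o\<^sub>L E) + (E o\<^sub>L Y n))"
      by simp
    also have "\<dots> \<le> (1/2) * (norm (Y (Suc n)) * norm E + norm E * norm (Y n))"
      using norm_triangle_ineq[of "Y (Suc n) o\<^sub>L E" "E o\<^sub>L Y n"]
        norm_blinfun_compose[of "Y (Suc n)" E] norm_blinfun_compose[of E "Y n"] by simp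
    also have "\<dots> \<le> (1/2) * (y (Suc n) * (y (Suc n) - y n) + (y (Suc n) - y n) * y n)"
      using Y_norm[of n] Y_norm[of "Suc n"] Suc y_bounds[of n] y_bounds[of "Suc n"] y_mono[of n]
      unfolding E_def[symmetric] by (intro mult_left_mono add_mono mult_mono) auto
    also have "\<dots> = y (Suc (Suc n)) - y (Suc n)"
      unfolding y_Suc[of "Suc n"] y_Suc[of n] by (simp add: power2_eq_square field_simps)
    finally show ?case .
  qed
  have "summable (\<lambda>n. Y (Suc n) - Y n)"
    by (rule summable_comparison_test'[OF summ_y, of 0]) (rule Y_step)
  then have "convergent (\<lambda>n. Y n - Y 0)"
    by (simp add: summable_iff_convergent sum_lessThan_telescope)
  then obtain Z where Z: "Y \<longlonglongrightarrow> Z"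
    by (auto simp: convergent_def Y_0)
  have "(\<lambda>n. (1/2) *\<^sub>R (A + (Y n o\<^sub>L Y n))) \<longlonglongrightarrow> (1/2) *\<^sub>R (A + (Z o\<^sub>L Z))"
    by (intro tendsto_intros bounded_bilinear.tendsto[OF bounded_bilinear_blinfun_compose] Z)
  moreover have "(\<lambda>n. (1/2) *\<^sub>R (A + (Y n o\<^sub>L Y n))) \<longlonglongrightarrow> Z"
    using LIMSEQ_Suc[OF Z] by (simp add: Y_Suc)
  ultimately have eq: "Z = (1/2) *\<^sub>R (A + (Z o\<^sub>L Z))"
    using LIMSEQ_unique by blast
  have lim: "(\<lambda>n. Y n x) \<longlonglongrightarrow> Z x" for x
    by (rule blinfun.tendsto[OF Z tendsto_const])
  have Y_clin: "Y n (a *\<^sub>C x) = a *\<^sub>C Y n x" for n a x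
    by (induction n arbitrary: x)
      (simp_all add: Y_0 Y_Suc clin blinfun.add_left blinfun.scaleR_left scaleC_add_right
        scaleC_scaleR_commute)
  have Y_sym: "cinner (Y n x) z = cinner x (Y n z)" for n x z
    by (induction n arbitrary: x z)
      (simp_all add: Y_0 Y_Suc sym blinfun.add_left blinfun.scaleR_left cinner_scaleR_left
        cinner_scaleR_right cinner_add_left cinner_add_right)
  show thesis
  proof
    have "2 *\<^sub>R Z = 2 *\<^sub>R ((1/2) *\<^sub>R (A + (Z o\<^sub>L Z)))"
      using eq by (rule arg_cong)
    then show "2 *\<^sub>R Z = A + (Z o\<^sub>L Z)" by simp
    show "Z (a *\<^sub>C x) = a *\<^sub>C Z x" for a x
      using lim[of "a *\<^sub>C x"] tendsto_scaleC[OF lim, of a x] unfolding Y_clin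
      by (rule LIMSEQ_unique)
    show "cinner (Z x) z = cinner x (Z z)" for x z
      using tendsto_cinner[OF lim tendsto_const, of x z] tendsto_cinner[OF tendsto_const lim, of x z]
      unfolding Y_sym by (rule LIMSEQ_unique)
  qed
qed

text \<open>
  After scaling \<open>S\<close> to a contraction \<open>S\<^sub>0\<close>, the operator \<open>A = 1 - S\<^sub>0\<^sup>* S\<^sub>0\<close> is a selfadjoint
  contraction, so the preceding lemma provides a selfadjoint square root of \<open>S\<^sub>0\<^sup>* S\<^sub>0\<close>. The
  equality of norms is what makes it behave like the modulus in the polar decomposition of \<open>S\<close>.
\<close>

lemma modulus_exists:
  fixes S :: "'a::chilbert_space \<Rightarrow> 'b::chilbert_space"
  assumes S: "bounded_clinear S"
  obtains R :: "'a \<Rightarrow> 'a" where "bounded_clinear R" and "\<And>x y. cinner (R x) y = cinner x (R y)"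
    and "\<And>x. norm (R x) = norm (S x)"
proof -
  obtain c where c: "c > 0" "\<And>x. norm (S x) \<le> c * norm x"
    using bounded_clinear_pos_bound[OF S] by blast
  define S0 where "S0 x = (1/c) *\<^sub>R S x" for x
  have S0: "bounded_clinear S0"
    using S unfolding S0_def bounded_clinear_def
    by (auto simp: scaleC_scaleR_commute intro: bounded_linear_const_scaleR)
  have S0_le: "norm (S0 x) \<le> norm x" for x
    using c(1) c(2)[of x] by (simp add: S0_def field_simps)
  obtain S1 where S1: "bounded_clinear S1" "\<And>x y. cinner (S0 x) y = cinner x (S1 y)"
    using adjoint_exists[OF S0] by blast
  define B where "B x = S1 (S0 x)" for x
  have B: "bounded_clinear B"
    unfolding B_def by (rule bounded_clinear_compose[OF S1(1) S0])
  have inner_B: "inner x (B z) = inner (S0 x) (S0 z)" for x z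
    by (simp add: Re_cinner[symmetric] S1 B_def)
  have B_le: "norm (B x) \<le> norm (S0 x)" for x
  proof (cases "B x = 0")
    case False
    have "norm (B x) * norm (B x) = inner (S0 (B x)) (S0 x)"
      by (simp add: inner_B[symmetric] power2_norm_eq_inner[symmetric] power2_eq_square)
    also have "\<dots> \<le> norm (S0 (B x)) * norm (S0 x)"
      by (rule norm_cauchy_schwarz)
    also have "\<dots> \<le> norm (B x) * norm (S0 x)"
      by (rule mult_right_mono[OF S0_le]) simp
    finally show ?thesis
      using False by simp
  qed simp
  have B_sym: "cinner (B x) y = cinner x (B y)" for x y
    by (metis B_def S1(2) cinner_commute)
  define A where "A = Blinfun (\<lambda>x. x - B x)"
  have A: "A x = x - B x" for x
    unfolding A_def
    by (subst bounded_linear_Blinfun_apply)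
      (simp_all add: bounded_linear_sub bounded_linear_ident bounded_clinear_bounded_linear[OF B])
  have "norm A \<le> 1"
  proof (rule norm_blinfun_bound)
    fix x
    have "(norm (x - B x))\<^sup>2 = (norm x)\<^sup>2 - 2 * (norm (S0 x))\<^sup>2 + (norm (B x))\<^sup>2"
      by (simp add: power2_norm_eq_inner inner_diff_left inner_diff_right inner_B[of x x] inner_commute[of "B x" x])
    also have "\<dots> \<le> (norm x)\<^sup>2"
    proof -
      have "(norm (B x))\<^sup>2 \<le> (norm (S0 x))\<^sup>2"
        by (rule power_mono[OF B_le]) simp
      then show ?thesis
        using zero_le_power2[of "norm (S0 x)"] by linarith
    qed
    finally have "norm (x - B x) \<le> norm x"
      by (rule power2_le_imp_le) simp
    then show "norm (A x) \<le> 1 * norm x"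
      by (simp add: A)
  qed simp
  moreover have "A (a *\<^sub>C x) = a *\<^sub>C A x" for a x
    by (simp add: A bounded_clinear_scaleC[OF B] cspace.scale_right_diff_distrib)
  moreover have "cinner (A x) y = cinner x (A y)" for x y
    by (simp add: A cinner_diff_left cinner_diff_right B_sym)
  ultimately obtain Y :: "'a \<Rightarrow>\<^sub>L 'a" where Y: "2 *\<^sub>R Y = A + (Y o\<^sub>L Y)"
      "\<And>a x. Y (a *\<^sub>C x) = a *\<^sub>C Y x" "\<And>x y. cinner (Y x) y = cinner x (Y y)"
    using selfadjoint_quadratic_equation by blast
  \<comment> \<open>the square root of \<open>B = S\<^sub>0\<^sup>* S\<^sub>0\<close>\<close>
  define Q where "Q x = x - Y x" for x
  have Q_sym: "cinner (Q x) y = cinner x (Q y)" for x y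
    by (simp add: Q_def cinner_diff_left cinner_diff_right Y(3))
  have QQ: "Q (Q x) = B x" for x
  proof -
    have "2 *\<^sub>R Y x = A x + Y (Y x)"
      using arg_cong[OF Y(1), of "\<lambda>Z. blinfun_apply Z x"]
      by (simp add: blinfun.scaleR_left blinfun.add_left)
    then show ?thesis
      by (simp add: Q_def A blinfun.diff_right scaleR_2 algebra_simps)
  qed
  have Q_norm: "norm (Q x) = norm (S0 x)" for x
  proof -
    have "inner (Q x) (Q x) = inner x (B x)"
      by (simp add: Re_cinner[symmetric] Q_sym QQ)
    then show ?thesis
      by (simp add: inner_B norm_eq_sqrt_inner)
  qed
  show thesis
  proof
    show "bounded_clinear (\<lambda>x. c *\<^sub>R Q x)"
      unfolding Q_def bounded_clinear_def
      by (auto simp: Y(2) scaleC_scaleR_commute cspace.scale_right_diff_distrib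
          intro!: bounded_linear_const_scaleR bounded_linear_sub bounded_linear_ident
            blinfun.bounded_linear_right)
    show "cinner (c *\<^sub>R Q x) y = cinner x (c *\<^sub>R Q y)" for x y
      by (simp add: cinner_scaleR_left cinner_scaleR_right Q_sym)
    show "norm (c *\<^sub>R Q x) = norm (S x)" for x
      using c(1) by (simp add: Q_norm S0_def)
  qed
qed

section \<open>Ranges of similar operators are unitarily equivalent\<close>

text \<open>
  The bound lets \<open>R1\<close> factor as \<open>D R2\<close> with \<open>D\<close> bounded; taking adjoints turns this into
  \<open>R1 = R2 D\<^sup>*\<close>, which is a statement about ranges. Ranges of selfadjoint operators thus depend only
  on the equivalence class of the seminorms \<open>\<lambda>x. norm (R x)\<close>.
\<close>

lemma range_subset_of_norm_le:
  fixes R1 R2 :: "'a::chilbert_space \<Rightarrow> 'a"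
  assumes "bounded_clinear R1" and "bounded_clinear R2"
    and sym1: "\<And>x y. cinner (R1 x) y = cinner x (R1 y)"
    and sym2: "\<And>x y. cinner (R2 x) y = cinner x (R2 y)"
    and bound: "\<And>x. norm (R1 x) \<le> c * norm (R2 x)"
  shows "range R1 \<subseteq> range R2"
proof -
  define G where "G = range (\<lambda>x. (R2 x, R1 x))"
  have "csubspace G"
    unfolding G_def
    by (intro csubspace_image bounded_clinear_Pair assms(1,2) csubspace_UNIV)
  moreover have "norm y \<le> c * norm x" if "(x, y) \<in> G" for x y
    using that bound by (auto simp: G_def)
  ultimately obtain D where D: "bounded_clinear D" "\<And>x y. (x, y) \<in> closure G \<Longrightarrow> D x = y"
    using operator_of_bounded_relation by metis
  have DR: "D (R2 x) = R1 x" for x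
    by (rule D(2), rule subsetD[OF closure_subset]) (simp add: G_def)
  obtain D' where "bounded_clinear D'" and D': "\<And>x y. cinner (D x) y = cinner x (D' y)"
    using adjoint_exists[OF D(1)] by blast
  have "R1 x = R2 (D' x)" for x
  proof (rule cinner_extensionality)
    fix z
    have "cinner (R1 x) z = cnj (cinner (D (R2 z)) x)"
      by (simp add: sym1 DR cinner_commute[of x])
    also have "\<dots> = cinner (R2 (D' x)) z"
      by (simp add: D' sym2 cinner_commute[of "D' x"])
    finally show "cinner (R1 x) z = cinner (R2 (D' x)) z" .
  qed
  then show ?thesis by auto
qed

text \<open>
  The crucial point of the theorem: an invertible operator can be replaced by a unitary one
  without changing the image of an operator range. Let \<open>R1\<close> and \<open>R2\<close> be the moduli of \<open>S\<close> and
  \<open>L S\<close>. They define equivalent seminorms because \<open>L\<close> is invertible, hence equal ranges. Therefore the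
  norm-preserving relation matching \<open>S x\<close> with \<open>L (S x')\<close> whenever \<open>R1 x = R2 x'\<close> has domain
  \<open>range S\<close> and range \<open>range (L S)\<close>.

  It remains to match the orthogonal complements of these ranges. They are isomorphic under
  the adjoint \<open>Q\<close> of the inverse of \<open>L\<close>. Extended by zero to an operator \<open>K\<close> on the whole space, this
  isomorphism is made isometric by matching \<open>R0 z\<close> with \<open>K z\<close>, where \<open>R0\<close> is the modulus of \<open>K\<close>.
  The sum of both relations has dense domain and dense range and so determines a unitary operator.
\<close>

lemma unitarily_equivalent_range_invertible_compose:
  fixes S :: "'a::chilbert_space \<Rightarrow> 'b::chilbert_space" and L :: "'b \<Rightarrow> 'b"
  assumes S: "bounded_clinear S" and L: "invertible_op L"
  shows "unitarily_equivalent (range S) (range (\<lambda>x. L (S x)))"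
proof -
  obtain J where L: "bounded_clinear L" and J: "bounded_clinear J"
    and JL: "\<And>x. J (L x) = x" and LJ: "\<And>x. L (J x) = x"
    using L unfolding invertible_op_def by (metis comp_apply id_apply)
  obtain cL where cL: "\<And>x. norm (L x) \<le> cL * norm x"
    using bounded_clinear_pos_bound[OF L] by blast
  obtain cJ where cJ: "\<And>x. norm (J x) \<le> cJ * norm x"
    using bounded_clinear_pos_bound[OF J] by blast
  have LS: "bounded_clinear (\<lambda>x. L (S x))"
    by (rule bounded_clinear_compose[OF L S])
  obtain R1 where R1: "bounded_clinear R1" "\<And>x y. cinner (R1 x) y = cinner x (R1 y)"
      "\<And>x. norm (R1 x) = norm (S x)"
    using modulus_exists[OF S] by blast
  obtain R2 where R2: "bounded_clinear R2" "\<And>x y. cinner (R2 x) y = cinner x (R2 y)"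
      "\<And>x. norm (R2 x) = norm (L (S x))"
    using modulus_exists[OF LS] by blast
  have range_R: "range R1 = range R2"
  proof
    show "range R1 \<subseteq> range R2"
      using cJ[of "L (S _)"]
      by (intro range_subset_of_norm_le[of R1 R2 cJ] R1 R2) (simp add: R1(3) R2(3) JL)
    show "range R2 \<subseteq> range R1"
      using cL by (intro range_subset_of_norm_le[of R2 R1 cL] R1 R2) (simp add: R1(3) R2(3))
  qed
  define N where "N = orth_compl (range S)"
  have N: "csubspace N" "closed N"
    by (simp_all add: N_def csubspace_orth_compl closed_orth_compl)
  obtain Q where Q: "bounded_clinear Q" "\<And>x y. cinner (J x) y = cinner x (Q y)"
    using adjoint_exists[OF J] by blast
  obtain L' where "bounded_clinear L'" and L': "\<And>x y. cinner (L x) y = cinner x (L' y)"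
    using adjoint_exists[OF L] by blast
  define K where "K x = Q (cproj N x)" for x
  have K: "bounded_clinear K"
    unfolding K_def by (rule bounded_clinear_compose[OF Q(1) bounded_clinear_cproj[OF N]])
  obtain R0 where R0: "bounded_clinear R0" "\<And>x y. cinner (R0 x) y = cinner x (R0 y)"
      "\<And>x. norm (R0 x) = norm (K x)"
    using modulus_exists[OF K] by blast
  have orth1: "cinner (S x) (R0 z) = 0" for x z
  proof -
    have "S x \<in> orth_compl N"
      unfolding N_def orth_compl_def by (auto intro: cinner_eq_zero_commute[THEN iffD1])
    then have "K (S x) = 0"
      by (simp add: K_def cproj_eq_0[OF N] bounded_clinear_0[OF Q(1)])
    then have "R0 (S x) = 0"
      using R0(3)[of "S x"] by simp
    then show ?thesis
      by (simp add: R0(2)[symmetric])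
  qed
  have orth2: "cinner (L (S x)) (K z) = 0" for x z
  proof -
    have "cinner (L (S x)) (K z) = cinner (S x) (cproj N z)"
      by (simp add: K_def Q(2)[symmetric] JL)
    also have "\<dots> = 0"
      using cproj_mem[OF N, of z] by (subst cinner_eq_zero_commute) (simp add: N_def orth_compl_def)
    finally show ?thesis .
  qed
  \<comment> \<open>\<open>G\<close> is the sum of the two relations: \<open>((x, x'), z)\<close> in \<open>W\<close> parametrizes the pair of
      \<open>S x + R0 z\<close> and \<open>L (S x') + K z\<close>.\<close>
  define W where "W = {p :: 'a \<times> 'a. R1 (fst p) = R2 (snd p)} \<times> (UNIV :: 'b set)"
  define \<Phi> where "\<Phi> q = (S (fst (fst q)) + R0 (snd q), L (S (snd (fst q))) + K (snd q))"
    for q :: "('a \<times> 'a) \<times> 'b"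
  define G where "G = \<Phi> ` W"
  have G_iff: "(u, v) \<in> G \<longleftrightarrow>
      (\<exists>x x' z. R1 x = R2 x' \<and> u = S x + R0 z \<and> v = L (S x') + K z)"
    (is "_ \<longleftrightarrow> ?rhs") for u v
  proof
    assume "(u, v) \<in> G"
    then obtain q where "q \<in> W" "(u, v) = \<Phi> q"
      by (auto simp: G_def)
    then show ?rhs
      by (intro exI[of _ "fst (fst q)"] exI[of _ "snd (fst q)"] exI[of _ "snd q"])
        (auto simp: W_def \<Phi>_def)
  next
    assume ?rhs
    then obtain x x' z where "R1 x = R2 x'" "u = S x + R0 z" "v = L (S x') + K z"
      by blast
    then show "(u, v) \<in> G"
      unfolding G_def by (intro image_eqI[of _ _ "((x, x'), z)"]) (auto simp: W_def \<Phi>_def)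
  qed
  have "csubspace W"
    unfolding W_def csubspace_def
    by (auto simp: mem_Times_iff scaleC_prod_def bounded_clinear_0[OF R1(1)] bounded_clinear_0[OF R2(1)]
        bounded_clinear_add[OF R1(1)] bounded_clinear_add[OF R2(1)]
        bounded_clinear_scaleC[OF R1(1)] bounded_clinear_scaleC[OF R2(1)])
  moreover have "bounded_clinear \<Phi>"
    unfolding \<Phi>_def
    by (intro bounded_clinear_Pair bounded_clinear_plus bounded_clinear_compose[OF S]
        bounded_clinear_compose[OF L] bounded_clinear_compose[OF R0(1)] bounded_clinear_compose[OF K]
        bounded_clinear_compose[OF bounded_clinear_fst] bounded_clinear_compose[OF bounded_clinear_snd]
        bounded_clinear_fst bounded_clinear_snd)
  ultimately have G: "csubspace G"
    unfolding G_def by (metis csubspace_image)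
  have iso: "norm v = norm u" if "(u, v) \<in> G" for u v
  proof -
    obtain x x' z where *: "R1 x = R2 x'" "u = S x + R0 z" "v = L (S x') + K z"
      using \<open>(u, v) \<in> G\<close> G_iff by blast
    have "norm (S x) = norm (L (S x'))"
      using *(1) by (simp add: R1(3)[symmetric] R2(3)[symmetric])
    then have "(norm v)\<^sup>2 = (norm u)\<^sup>2"
      unfolding *(2,3) pythagoras_cinner[OF orth1] pythagoras_cinner[OF orth2] R0(3) by simp
    then show ?thesis
      by (simp add: power2_eq_iff_nonneg)
  qed
  have ex1: "\<exists>x'. R1 x = R2 x'" and ex2: "\<exists>x'. R1 x' = R2 x" for x
    using range_R by (metis rangeI imageE)+
  have G_left: "\<exists>v. (S x + R0 z, v) \<in> G" and G_right: "\<exists>u. (u, L (S x) + K z) \<in> G" for x z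
    using ex1[of x] ex2[of x] G_iff by blast+
  have dense1: "closure (fst ` G) = UNIV"
  proof (rule closure_eq_UNIV_of_orth_compl)
    show "csubspace (fst ` G)"
      by (rule csubspace_image[OF bounded_clinear_fst G])
    fix y assume y: "y \<in> orth_compl (fst ` G)"
    have perp: "cinner y (S x + R0 z) = 0" for x z
      using G_left[of x z] y unfolding orth_compl_def by force
    have "y \<in> N"
      using perp[of _ 0] by (auto simp: N_def orth_compl_def bounded_clinear_0[OF R0(1)])
    \<comment> \<open>\<open>R0 y = 0\<close> forces \<open>y = 0\<close> because \<open>Q\<close> is injective and \<open>y\<close> lies in \<open>N\<close>.\<close>
    have "cinner (R0 y) (R0 y) = 0"
      using perp[of 0 "R0 y"] by (simp add: R0(2)[symmetric] bounded_clinear_0[OF S] R0(2)[of y])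
    then have "K y = 0"
      using R0(3)[of y] by simp
    then have "Q y = 0"
      using \<open>y \<in> N\<close> by (simp add: K_def cproj_ident[OF N])
    then have "cinner (J (L y)) y = 0"
      by (simp add: Q(2))
    then show "y = 0"
      by (simp add: JL)
  qed
  have dense2: "closure (snd ` G) = UNIV"
  proof (rule closure_eq_UNIV_of_orth_compl)
    show "csubspace (snd ` G)"
      by (rule csubspace_image[OF bounded_clinear_snd G])
    fix y assume y: "y \<in> orth_compl (snd ` G)"
    have perp: "cinner y (L (S x) + K z) = 0" for x z
      using G_right[of x z] y unfolding orth_compl_def by force
    \<comment> \<open>\<open>y\<close> is orthogonal to \<open>range (L S)\<close>, hence equal to \<open>K (L\<^sup>* y)\<close>, to which it is orthogonal as well.\<close>
    have "cinner (S x) (L' y) = 0" for x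
      using perp[of x 0]
      by (simp add: bounded_clinear_0[OF K] L'[symmetric] cinner_eq_zero_commute[of y])
    then have "L' y \<in> N"
      by (auto simp: N_def orth_compl_def intro: cinner_eq_zero_commute[THEN iffD1])
    moreover have "Q (L' y) = y"
    proof -
      have "cinner u (Q (L' y)) = cinner u y" for u
        by (simp add: Q(2)[symmetric] L'[symmetric] LJ)
      then have "cinner (Q (L' y)) u = cinner y u" for u
        using cinner_commute[of y u] cinner_commute[of "Q (L' y)" u] by simp
      then show ?thesis
        by (rule cinner_extensionality)
    qed
    ultimately have "K (L' y) = y"
      by (simp add: K_def cproj_ident[OF N])
    then show "y = 0"
      using perp[of 0 "L' y"] by (simp add: bounded_clinear_0[OF S] bounded_clinear_0[OF L])
  qed
  obtain U where U: "unitary_op U" "\<And>u v. (u, v) \<in> G \<Longrightarrow> U u = v"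
    using unitary_of_isometric_relation[OF G _ dense1 dense2] iso by blast
  have US: "U (S x) = L (S x')" if "R1 x = R2 x'" for x x'
  proof (rule U(2))
    show "(S x, L (S x')) \<in> G"
      unfolding G_iff using that
      by (intro exI[of _ x] exI[of _ x'] exI[of _ 0])
        (simp add: bounded_clinear_0[OF R0(1)] bounded_clinear_0[OF K])
  qed
  have "range (\<lambda>x. L (S x)) = U ` range S"
  proof
    show "range (\<lambda>x. L (S x)) \<subseteq> U ` range S"
      using US ex2 by (metis (no_types, lifting) image_subsetI rangeI image_eqI)
    show "U ` range S \<subseteq> range (\<lambda>x. L (S x))"
      using US ex1 by (auto simp: image_iff) metis
  qed
  then show ?thesis
    unfolding unitarily_equivalent_def using U(1) by blast
qed

section \<open>Orthonormal bases and Hilbert space dimension\<close>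

text \<open>
  A maximal orthonormal subset of \<open>N\<close>, given by Zorn's lemma, spans \<open>N\<close>: otherwise a
  normalized vector of \<open>N\<close> orthogonal to its closed span could be added.
\<close>

lemma orthonormal_basis_exists:
  assumes N: "csubspace N" "closed N"
  shows "\<exists>B. orthonormal_basis_of B N"
proof -
  define A where "A = {B. B \<subseteq> N \<and> (\<forall>x\<in>B. norm x = 1) \<and> (\<forall>x\<in>B. \<forall>y\<in>B. x \<noteq> y \<longrightarrow> cinner x y = 0)}"
  have "\<exists>M\<in>A. \<forall>X\<in>A. M \<subseteq> X \<longrightarrow> X = M"
  proof (rule subset_Zorn')
    fix \<C> assume C: "subset.chain A \<C>"
    then have CA: "\<C> \<subseteq> A"
      by (simp add: subset_chain_def)
    have "cinner x y = 0" if xy: "X \<in> \<C>" "Y \<in> \<C>" "x \<in> X" "y \<in> Y" "x \<noteq> y" for x y X Y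
    proof -
      have "X \<subseteq> Y \<or> Y \<subseteq> X"
        using C xy by (auto simp: subset_chain_def)
      then obtain Z where "Z \<in> \<C>" "x \<in> Z" "y \<in> Z"
        using xy by blast
      then show ?thesis
        using CA xy(5) by (auto simp: A_def)
    qed
    then show "\<Union>\<C> \<in> A"
      using CA by (auto simp: A_def)
  qed
  then obtain B where B: "B \<in> A" and max: "\<And>X. X \<in> A \<Longrightarrow> B \<subseteq> X \<Longrightarrow> X = B"
    by blast
  define S where "S = closure (csubspace hull B)"
  have S: "csubspace S" "closed S"
    by (auto simp: S_def intro: csubspace_closure csubspace_hull)
  have BS: "B \<subseteq> S"
    unfolding S_def by (meson closure_subset hull_subset order_trans)
  have SN: "S \<subseteq> N"
    unfolding S_def using B N by (intro closure_hull_subset) (auto simp: A_def)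
  have "x \<in> S" if "x \<in> N" for x
  proof (rule ccontr)
    assume "x \<notin> S"
    define e where "e = x - cproj S x"
    have "e \<noteq> 0"
      using cproj_mem[OF S, of x] \<open>x \<notin> S\<close> by (auto simp: e_def)
    define u where "u = (1 / norm e) *\<^sub>R e"
    have u_norm: "norm u = 1"
      using \<open>e \<noteq> 0\<close> by (simp add: u_def)
    have u_orth: "u \<in> orth_compl S"
      unfolding u_def e_def
      by (intro csubspace_scaleR csubspace_orth_compl diff_cproj_mem S)
    have u_N: "u \<in> N"
      unfolding u_def e_def
      using that SN cproj_mem[OF S] by (intro csubspace_scaleR csubspace_diff N(1)) auto
    have uB: "cinner u b = 0" "cinner b u = 0" if "b \<in> B" for b
      using u_orth BS that cinner_eq_zero_commute[of u b] by (auto simp: orth_compl_def)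
    have "insert u B \<in> A"
      using B u_N u_norm uB by (auto simp: A_def)
    then have "insert u B = B"
      by (intro max) auto
    then have "cinner u u = 0"
      using uB(1)[of u] by auto
    then show False
      using u_norm by simp
  qed
  then have "S = N"
    using SN by auto
  then show ?thesis
    using B by (auto simp: orthonormal_basis_of_def A_def S_def)
qed

lemma hilbert_dim_basis:
  assumes "csubspace N" and "closed N"
  obtains B where "orthonormal_basis_of B N" and "hilbert_dim N = card_of B"
  using someI_ex[OF orthonormal_basis_exists[OF assms]] unfolding hilbert_dim_def by blast

lemma orthonormal_basis_cinner:
  assumes "orthonormal_basis_of B N" and "x \<in> B" and "y \<in> B"
  shows "cinner x y = (if x = y then 1 else 0)"
  using assms by (auto simp: orthonormal_basis_of_def cinner_self)

lemma orthonormal_basis_subset: "orthonormal_basis_of B N \<Longrightarrow> B \<subseteq> N"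
  unfolding orthonormal_basis_of_def by (metis closure_subset hull_subset order_trans)

lemma orthonormal_basis_induct:
  assumes "orthonormal_basis_of B N" and "B \<subseteq> S" and "csubspace S" and "closed S"
  shows "N \<subseteq> S"
  using assms closure_hull_subset unfolding orthonormal_basis_of_def by metis

text \<open>
  The vectors with countable support form a closed subspace, since the support of a limit lies in
  the union of the supports of the approximating sequence. Basis vectors have one-element support.
\<close>

lemma countable_support_orthonormal_basis:
  assumes C: "orthonormal_basis_of C N" and "y \<in> N"
  shows "countable {c\<in>C. cinner y c \<noteq> 0}"
proof -
  define S where "S = {y. countable {c\<in>C. cinner y c \<noteq> 0}}"
  have "N \<subseteq> S"
  proof (rule orthonormal_basis_induct[OF C])
    show "C \<subseteq> S"
    proof
      fix x assume "x \<in> C"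
      then have "{c\<in>C. cinner x c \<noteq> 0} \<subseteq> {x}"
        using orthonormal_basis_cinner[OF C] by (auto split: if_splits)
      from countable_subset[OF this] show "x \<in> S"
        by (simp add: S_def)
    qed
    show "csubspace S"
      unfolding csubspace_def
    proof (intro conjI ballI allI)
      show "x + y \<in> S" if "x \<in> S" "y \<in> S" for x y
      proof -
        have "{c\<in>C. cinner (x + y) c \<noteq> 0} \<subseteq> {c\<in>C. cinner x c \<noteq> 0} \<union> {c\<in>C. cinner y c \<noteq> 0}"
          by (auto simp: cinner_add_left)
        from countable_subset[OF this] show ?thesis
          using that by (simp add: S_def)
      qed
      show "a *\<^sub>C x \<in> S" if "x \<in> S" for a x
      proof -
        have "{c\<in>C. cinner (a *\<^sub>C x) c \<noteq> 0} \<subseteq> {c\<in>C. cinner x c \<noteq> 0}"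
          by (auto simp: cinner_scaleC_left)
        from countable_subset[OF this] show ?thesis
          using that by (simp add: S_def)
      qed
    qed (simp add: S_def)
    show "closed S"
      unfolding closed_sequential_limits
    proof (intro allI impI, elim conjE)
      fix f x assume f: "\<forall>n. f n \<in> S" "f \<longlonglongrightarrow> x"
      have "{c\<in>C. cinner x c \<noteq> 0} \<subseteq> (\<Union>n. {c\<in>C. cinner (f n) c \<noteq> 0})"
      proof clarify
        fix c assume c: "c \<in> C" "cinner x c \<noteq> 0"
        have "\<exists>n. cinner (f n) c \<noteq> 0"
        proof (rule ccontr)
          assume "\<nexists>n. cinner (f n) c \<noteq> 0"
          then have "(\<lambda>n. 0) \<longlonglongrightarrow> cinner x c"
            using tendsto_cinner[OF f(2) tendsto_const, of c] by simp
          then show False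
            using c(2) LIMSEQ_unique tendsto_const by blast
        qed
        then show "c \<in> (\<Union>n. {c\<in>C. cinner (f n) c \<noteq> 0})"
          using c(1) by blast
      qed
      moreover have "countable (\<Union>n. {c\<in>C. cinner (f n) c \<noteq> 0})"
        using f(1) by (intro countable_UN) (auto simp: S_def)
      ultimately show "x \<in> S"
        unfolding S_def mem_Collect_eq by (rule countable_subset)
    qed
  qed
  then show ?thesis
    using assms(2) by (auto simp: S_def)
qed

text \<open>
  If \<open>B\<close> is finite, \<open>N\<close> is its algebraic span and the claim is the bound on the size of an
  independent set in the span of \<open>M ` B\<close>. If \<open>B\<close> is infinite, no element of \<open>C\<close> is orthogonal to
  all of \<open>M ` B\<close>, so \<open>C\<close> is covered by the countable supports of the vectors \<open>M b\<close>. For \<open>M\<close> the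
  identity this is the independence of the dimension from the choice of basis.
\<close>

lemma card_basis_image_le:
  fixes M :: "'a::chilbert_space \<Rightarrow> 'b::chilbert_space"
  assumes M: "bounded_clinear M"
    and B: "orthonormal_basis_of B N" and C: "orthonormal_basis_of C N'"
    and image: "M ` N = N'"
  shows "(card_of C, card_of B) \<in> ordLeq"
proof (cases "finite B")
  case True
  have "N \<subseteq> {x. x = (\<Sum>b\<in>B. cinner x b *\<^sub>C b)}"
  proof (rule orthonormal_basis_induct[OF B])
    show "B \<subseteq> {x. x = (\<Sum>b\<in>B. cinner x b *\<^sub>C b)}"
    proof clarify
      fix x assume "x \<in> B"
      have "(\<Sum>b\<in>B. cinner x b *\<^sub>C b) = (\<Sum>b\<in>B. if b = x then x else 0)"
        using orthonormal_basis_cinner[OF B \<open>x \<in> B\<close>] by (intro sum.cong) auto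
      then show "x = (\<Sum>b\<in>B. cinner x b *\<^sub>C b)"
        using True \<open>x \<in> B\<close> by simp
    qed
    have "bounded_clinear (\<lambda>x. x - (\<Sum>b\<in>B. cinner x b *\<^sub>C b))"
      by (intro bounded_clinear_minus bounded_clinear_id bounded_clinear_sum
          bounded_clinear_scaleC_const bounded_clinear_cinner_left)
    moreover have "{x. x = (\<Sum>b\<in>B. cinner x b *\<^sub>C b)}
        = ker_op (\<lambda>x. x - (\<Sum>b\<in>B. cinner x b *\<^sub>C b))"
      by (simp add: ker_op_def)
    ultimately show "csubspace {x. x = (\<Sum>b\<in>B. cinner x b *\<^sub>C b)}"
        and "closed {x. x = (\<Sum>b\<in>B. cinner x b *\<^sub>C b)}"
      by (simp_all only: csubspace_ker closed_ker)
  qed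
  then have expansion: "(\<Sum>b\<in>B. cinner x b *\<^sub>C b) = x" if "x \<in> N" for x
    using that by fastforce
  have "(\<Sum>b\<in>B. cinner x b *\<^sub>C b) \<in> cspace.span B" for x
    by (intro cspace.span_sum cspace.span_scale cspace.span_base)
  then have N_span: "N \<subseteq> cspace.span B"
    using expansion by (metis subsetI)
  have sub: "cspace.subspace (M -` cspace.span (M ` B))"
    using csubspace_vimage[OF M, of "cspace.span (M ` B)"] by (simp add: csubspace_iff_subspace)
  have "cspace.span B \<subseteq> M -` cspace.span (M ` B)"
    by (intro cspace.span_minimal sub) (auto intro: cspace.span_base)
  then have "N' \<subseteq> cspace.span (M ` B)"
    using N_span image by blast
  then have "C \<subseteq> cspace.span (M ` B)"
    using orthonormal_basis_subset[OF C] by blast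
  moreover have "\<not> cspace.dependent C"
  proof
    assume "cspace.dependent C"
    then obtain a where a: "a \<in> C" "a \<in> cspace.span (C - {a})"
      unfolding cspace.dependent_def by blast
    have "cspace.span (C - {a}) \<subseteq> {x. cinner x a = 0}"
      using orthonormal_basis_cinner[OF C _ a(1)]
      by (intro cspace.span_minimal)
        (auto simp: cspace.subspace_def cinner_add_left cinner_scaleC_left)
    then show False
      using a orthonormal_basis_cinner[OF C a(1) a(1)] by auto
  qed
  ultimately have "finite C \<and> card C \<le> card (M ` B)"
    using True by (intro cspace.independent_span_bound) auto
  then show ?thesis
    using True card_image_le[OF True, of M] inj_on_iff_card_le[of C B] card_of_ordLeq[of C B]
    by (metis order_trans)
next
  case False
  have "C \<subseteq> (\<Union>b\<in>B. {c\<in>C. cinner (M b) c \<noteq> 0})"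
  proof
    fix c assume c: "c \<in> C"
    show "c \<in> (\<Union>b\<in>B. {c\<in>C. cinner (M b) c \<noteq> 0})"
    proof (rule ccontr)
      assume "c \<notin> (\<Union>b\<in>B. {c\<in>C. cinner (M b) c \<noteq> 0})"
      then have "B \<subseteq> M -` orth_compl {c}"
        using c by (auto simp: orth_compl_def)
      then have "N \<subseteq> M -` orth_compl {c}"
        by (intro orthonormal_basis_induct[OF B] csubspace_vimage closed_vimage_bounded_clinear M
            csubspace_orth_compl closed_orth_compl)
      then have "c \<in> orth_compl {c}"
        using c orthonormal_basis_subset[OF C] image by blast
      then show False
        using orthonormal_basis_cinner[OF C c c] by (simp add: orth_compl_def)
    qed
  qed
  then have "(card_of C, card_of (\<Union>b\<in>B. {c\<in>C. cinner (M b) c \<noteq> 0})) \<in> ordLeq"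
    by (rule card_of_mono1)
  moreover have "(card_of (\<Union>b\<in>B. {c\<in>C. cinner (M b) c \<noteq> 0}), card_of B) \<in> ordLeq"
  proof (rule card_of_UNION_ordLeq_infinite[OF False])
    show "(card_of B, card_of B) \<in> ordLeq"
      by (simp add: card_of_mono1)
    show "\<forall>b\<in>B. (card_of {c\<in>C. cinner (M b) c \<noteq> 0}, card_of B) \<in> ordLeq"
    proof
      fix b assume "b \<in> B"
      then have "M b \<in> N'"
        using orthonormal_basis_subset[OF B] image by blast
      then have "countable {c\<in>C. cinner (M b) c \<noteq> 0}"
        by (rule countable_support_orthonormal_basis[OF C])
      then obtain f :: "'b \<Rightarrow> nat" where "inj_on f {c\<in>C. cinner (M b) c \<noteq> 0}"
        by (auto simp: countable_def)
      then have "(card_of {c\<in>C. cinner (M b) c \<noteq> 0}, card_of (UNIV :: nat set)) \<in> ordLeq"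
        using card_of_ordLeq by blast
      moreover have "(card_of (UNIV :: nat set), card_of B) \<in> ordLeq"
        using False by (simp add: infinite_iff_card_of_nat)
      ultimately show "(card_of {c\<in>C. cinner (M b) c \<noteq> 0}, card_of B) \<in> ordLeq"
        by (rule ordLeq_transitive)
    qed
  qed
  ultimately show ?thesis
    by (rule ordLeq_transitive)
qed

lemma hilbert_dim_image_le:
  assumes "bounded_clinear M" and "csubspace N" and "closed N" and "csubspace N'" and "closed N'"
    and "M ` N = N'"
  shows "(hilbert_dim N', hilbert_dim N) \<in> ordLeq"
  using assms card_basis_image_le hilbert_dim_basis by metis

text \<open>
  A bijection between the bases spans a linear relation in the direct sum. It preserves inner
  products on the generators, hence, fixing one argument at a time, on their span.
\<close>

lemma isometries_of_hilbert_dim_eq: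
  fixes N :: "'a::chilbert_space set" and N' :: "'b::chilbert_space set"
  assumes N: "csubspace N" "closed N" and N': "csubspace N'" "closed N'"
    and dim: "(hilbert_dim N, hilbert_dim N') \<in> ordIso"
  obtains V W where "bounded_clinear V" and "bounded_clinear W"
    and "\<And>x. x \<in> N \<Longrightarrow> V x \<in> N' \<and> W (V x) = x \<and> norm (V x) = norm x"
    and "\<And>y. y \<in> N' \<Longrightarrow> W y \<in> N \<and> V (W y) = y"
proof -
  obtain B where B: "orthonormal_basis_of B N" "hilbert_dim N = card_of B"
    by (rule hilbert_dim_basis[OF N])
  obtain C where C: "orthonormal_basis_of C N'" "hilbert_dim N' = card_of C"
    by (rule hilbert_dim_basis[OF N'])
  have "(card_of B, card_of C) \<in> ordIso"
    using dim unfolding B(2) C(2) .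
  then obtain f where f: "bij_betw f B C"
    using card_of_ordIso by blast
  define G0 where "G0 = (\<lambda>b. (b, f b)) ` B"
  define G where "G = csubspace hull G0"
  have G: "csubspace G"
    unfolding G_def by (rule csubspace_hull)
  have sub: "csubspace {p. cinner (snd p) (snd q) = cinner (fst p) (fst q)}" for q :: "'a \<times> 'b"
    by (simp add: csubspace_def scaleC_prod_def cinner_add_left cinner_scaleC_left)
  have f_cinner: "cinner (f b) (f b') = cinner b b'" if "b \<in> B" "b' \<in> B" for b b'
  proof -
    have "f b \<in> C" "f b' \<in> C" "f b = f b' \<longleftrightarrow> b = b'"
      using f that by (auto simp: bij_betw_def inj_on_def)
    then show ?thesis
      using that by (simp add: orthonormal_basis_cinner[OF B(1)] orthonormal_basis_cinner[OF C(1)])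
  qed
  have pres0: "cinner (snd p) (snd q) = cinner (fst p) (fst q)" if "p \<in> G" "q \<in> G0" for p q
  proof -
    have "G \<subseteq> {p. cinner (snd p) (snd q) = cinner (fst p) (fst q)}"
      unfolding G_def using that(2) f_cinner by (intro hull_minimal sub) (auto simp: G0_def)
    then show ?thesis
      using that(1) by blast
  qed
  have pres: "cinner (snd p) (snd q) = cinner (fst p) (fst q)" if "p \<in> G" "q \<in> G" for p q
  proof -
    have "cinner (snd r) (snd q) = cinner (fst r) (fst q)" if "r \<in> G0" for r
      using pres0[OF \<open>q \<in> G\<close> that] cinner_commute[of "snd r" "snd q"] cinner_commute[of "fst r" "fst q"]
      by simp
    then have "G \<subseteq> {p. cinner (snd p) (snd q) = cinner (fst p) (fst q)}"
      unfolding G_def by (intro hull_minimal sub) auto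
    then show ?thesis
      using that(1) by blast
  qed
  have iso: "norm y = norm x" if "(x, y) \<in> G" for x y
  proof -
    have "complex_of_real ((norm y)\<^sup>2) = complex_of_real ((norm x)\<^sup>2)"
      using pres[OF that that] by (simp only: cinner_self[symmetric] fst_conv snd_conv)
    then show ?thesis
      by (simp only: of_real_eq_iff power2_eq_iff_nonneg norm_ge_zero)
  qed
  have "G0 \<subseteq> N \<times> N'"
    using orthonormal_basis_subset[OF B(1)] orthonormal_basis_subset[OF C(1)] f
    by (auto simp: G0_def bij_betw_def)
  moreover have "csubspace (N \<times> N')"
    using N(1) N'(1) by (auto simp: csubspace_def scaleC_prod_def mem_Times_iff)
  ultimately have "G \<subseteq> N \<times> N'"
    unfolding G_def by (rule hull_minimal)
  then have "fst ` G \<subseteq> N" "snd ` G \<subseteq> N'"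
    by auto
  then have "closure (fst ` G) \<subseteq> N" "closure (snd ` G) \<subseteq> N'"
    using N(2) N'(2) by (simp_all add: closure_minimal)
  moreover have "N \<subseteq> closure (fst ` G)"
  proof (rule orthonormal_basis_induct[OF B(1)])
    have "G0 \<subseteq> G"
      unfolding G_def by (rule hull_subset)
    then have "fst ` G0 \<subseteq> closure (fst ` G)"
      by (meson closure_subset image_mono order_trans)
    then show "B \<subseteq> closure (fst ` G)"
      by (simp add: G0_def image_image)
  qed (auto intro: csubspace_closure csubspace_image bounded_clinear_fst G)
  moreover have "N' \<subseteq> closure (snd ` G)"
  proof (rule orthonormal_basis_induct[OF C(1)])
    have "G0 \<subseteq> G"
      unfolding G_def by (rule hull_subset)
    then have "snd ` G0 \<subseteq> closure (snd ` G)"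
      by (meson closure_subset image_mono order_trans)
    moreover have "snd ` G0 = C"
      using f by (simp add: G0_def image_image bij_betw_def)
    ultimately show "C \<subseteq> closure (snd ` G)"
      by simp
  qed (auto intro: csubspace_closure csubspace_image bounded_clinear_snd G)
  ultimately have cl: "closure (fst ` G) = N" "closure (snd ` G) = N'"
    by blast+
  show thesis
  proof (rule isometries_of_relation[OF G])
    show "norm y = norm x" if "(x, y) \<in> G" for x y
      by (rule iso[OF that])
  next
    fix V W
    assume VW: "bounded_clinear V" "bounded_clinear W"
      "\<And>x. x \<in> closure (fst ` G) \<Longrightarrow>
        V x \<in> closure (snd ` G) \<and> W (V x) = x \<and> norm (V x) = norm x"
      "\<And>y. y \<in> closure (snd ` G) \<Longrightarrow> W y \<in> closure (fst ` G) \<and> V (W y) = y"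
    show thesis
    proof (rule that[OF VW(1,2)])
      show "V x \<in> N' \<and> W (V x) = x \<and> norm (V x) = norm x" if "x \<in> N" for x
        using VW(3)[of x] that by (simp add: cl)
      show "W y \<in> N \<and> V (W y) = y" if "y \<in> N'" for y
        using VW(4)[of y] that by (simp add: cl)
    qed
  qed
qed

section \<open>The closed graph theorem and factorization through a range\<close>

text \<open>
  By Baire's theorem the set \<open>S n\<close> of vectors with an image of norm at most \<open>n\<close> is dense in some
  ball. Translation and scaling give every \<open>x\<close> an approximation \<open>g x\<close> within half its norm whose
  image \<open>h x\<close> is bounded by a multiple of \<open>norm x\<close>. Approximating the remainder again and again
  writes \<open>x\<close> as a series whose images are dominated by a geometric series; closedness of the
  graph identifies their sum with the image of \<open>x\<close>, so the image obeys a uniform bound.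
\<close>

lemma operator_of_closed_graph:
  fixes G :: "('a::chilbert_space \<times> 'b::chilbert_space) set"
  assumes G: "csubspace G" "closed G"
    and total: "\<And>x. \<exists>y. (x, y) \<in> G"
    and single: "\<And>y. (0, y) \<in> G \<Longrightarrow> y = 0"
  obtains C where "bounded_clinear C" and "\<And>x. (x, C x) \<in> G"
proof -
  define S where "S n = {x. \<exists>y. (x, y) \<in> G \<and> norm y \<le> real n}" for n
  have "\<exists>n. interior (closure (S n)) \<noteq> {}"
  proof (rule ccontr)
    assume "\<nexists>n. interior (closure (S n)) \<noteq> {}"
    then have "Met_TC.mtopology interior_of \<Union>(range (\<lambda>n. closure (S n))) = {}"
      by (intro Met_TC.metric_Baire_category_alt) (auto simp: complete_UNIV)
    moreover have "\<Union>(range (\<lambda>n. closure (S n))) = UNIV"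
    proof -
      have "\<exists>n. x \<in> closure (S n)" for x
      proof -
        obtain y where "(x, y) \<in> G"
          using total by blast
        moreover obtain n where "norm y \<le> real n"
          using real_arch_simple by blast
        ultimately have "x \<in> S n"
          by (auto simp: S_def)
        then show ?thesis
          using closure_subset by blast
      qed
      then show ?thesis by blast
    qed
    ultimately show False by simp
  qed
  then obtain n a r where r: "r > 0" and ball: "ball a r \<subseteq> closure (S n)"
    by (metis all_not_in_conv mem_interior)
  have near: "\<exists>x' y'. (x', y') \<in> G \<and> norm (x - x') < e \<and> norm y' \<le> 2 * real n"
    if x: "norm x < r" and e: "e > 0" for x e
  proof -
    have "a + x \<in> closure (S n)" "a \<in> closure (S n)"
      using ball x r by (auto simp: dist_norm)
    then obtain p q where pq: "p \<in> S n" "dist p (a + x) < e / 2" "q \<in> S n" "dist q a < e / 2"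
      using e unfolding closure_approachable by (metis half_gt_zero)
    then obtain y z where yz: "(p, y) \<in> G" "norm y \<le> real n" "(q, z) \<in> G" "norm z \<le> real n"
      by (auto simp: S_def)
    have "(p - q, y - z) \<in> G"
      using csubspace_diff[OF G(1) yz(1,3)] by simp
    moreover have "norm (x - (p - q)) < e"
      using norm_triangle_ineq4[of "q - a" "p - (a + x)"] pq(2,4) by (simp add: dist_norm algebra_simps)
    moreover have "norm (y - z) \<le> 2 * real n"
      using norm_triangle_ineq4[of y z] yz(2,4) by simp
    ultimately show ?thesis by blast
  qed
  define k where "k = 4 * real n / r"
  have half: "\<exists>x' y'. (x', y') \<in> G \<and> norm (x - x') \<le> norm x / 2 \<and> norm y' \<le> k * norm x" for x
  proof (cases "x = 0")
    case True
    then show ?thesis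
      using csubspace_0[OF G(1)] by (intro exI[of _ 0]) (simp add: zero_prod_def)
  next
    case False
    define t where "t = r / (2 * norm x)"
    have t: "t > 0"
      using r False by (simp add: t_def)
    have "norm (t *\<^sub>R x) < r" "t * norm x / 2 > 0"
      using r False by (simp_all add: t_def)
    then obtain x' y' where *: "(x', y') \<in> G" "norm (t *\<^sub>R x - x') < t * norm x / 2" "norm y' \<le> 2 * real n"
      using near by blast
    have "(inverse t *\<^sub>R x', inverse t *\<^sub>R y') \<in> G"
      using csubspace_scaleR[OF G(1) *(1), of "inverse t"] by simp
    moreover have "norm (x - inverse t *\<^sub>R x') \<le> norm x / 2"
    proof -
      have "x - inverse t *\<^sub>R x' = inverse t *\<^sub>R (t *\<^sub>R x - x')"
        using t by (simp add: scaleR_diff_right)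
      then have "norm (x - inverse t *\<^sub>R x') = inverse t * norm (t *\<^sub>R x - x')"
        using t by simp
      also have "\<dots> \<le> inverse t * (t * norm x / 2)"
        using *(2) t by (intro mult_left_mono) auto
      also have "\<dots> = norm x / 2"
        using t by simp
      finally show ?thesis .
    qed
    moreover have "norm (inverse t *\<^sub>R y') \<le> k * norm x"
    proof -
      have "norm (inverse t *\<^sub>R y') \<le> inverse t * (2 * real n)"
        using *(3) t by simp
      also have "\<dots> = k * norm x"
        using r False by (simp add: t_def k_def field_simps)
      finally show ?thesis .
    qed
    ultimately show ?thesis by blast
  qed
  obtain g h where gh: "\<And>x. (g x, h x) \<in> G" "\<And>x. norm (x - g x) \<le> norm x / 2"
      "\<And>x. norm (h x) \<le> k * norm x"
    using half by metis
  have k: "k \<ge> 0"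
    using r by (simp add: k_def)
  have bound: "norm y \<le> (2 * k) * norm x" if xy: "(x, y) \<in> G" for x y
  proof -
    define \<rho> where "\<rho> m = ((\<lambda>x. x - g x) ^^ m) x" for m
    have \<rho>_Suc: "\<rho> (Suc m) = \<rho> m - g (\<rho> m)" for m
      by (simp add: \<rho>_def)
    have \<rho>_le: "norm (\<rho> m) \<le> norm x * (1/2) ^ m" for m
    proof (induction m)
      case (Suc m)
      then show ?case
        using gh(2)[of "\<rho> m"] by (simp add: \<rho>_Suc)
    qed (simp add: \<rho>_def)
    have h_le: "norm (h (\<rho> m)) \<le> (k * norm x) * (1/2) ^ m" for m
      using gh(3)[of "\<rho> m"] mult_left_mono[OF \<rho>_le[of m] k] by (simp add: mult.assoc)
    have geo: "(\<lambda>m. (k * norm x) * (1/2) ^ m) sums ((k * norm x) * 2)"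
      using geometric_sums[of "1/2 :: real"] by (intro sums_mult) simp
    have partial: "(x - \<rho> m, \<Sum>i<m. h (\<rho> i)) \<in> G" for m
    proof (induction m)
      case 0
      then show ?case
        using csubspace_0[OF G(1)] by (simp add: \<rho>_def zero_prod_def)
    next
      case (Suc m)
      then show ?case
        using csubspace_add[OF G(1) Suc gh(1)[of "\<rho> m"]] by (simp add: \<rho>_Suc algebra_simps)
    qed
    have summ: "summable (\<lambda>i. h (\<rho> i))"
      by (rule summable_comparison_test'[OF sums_summable[OF geo], of 0]) (rule h_le)
    have "(\<lambda>m. norm x * (1/2) ^ m) \<longlonglongrightarrow> norm x * 0"
      by (intro tendsto_intros LIMSEQ_power_zero) simp
    then have "\<rho> \<longlonglongrightarrow> 0"
      using \<rho>_le by (intro Lim_null_comparison[of \<rho>]) auto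
    then have "(\<lambda>m. x - \<rho> m) \<longlonglongrightarrow> x - 0"
      by (intro tendsto_intros)
    then have "(\<lambda>m. (x - \<rho> m, \<Sum>i<m. h (\<rho> i))) \<longlonglongrightarrow> (x - 0, \<Sum>i. h (\<rho> i))"
      using summable_LIMSEQ[OF summ] by (rule tendsto_Pair)
    then have "(x, \<Sum>i. h (\<rho> i)) \<in> G"
      using closed_sequentially[OF G(2)] partial by fastforce
    then have "y = (\<Sum>i. h (\<rho> i))"
      using single[of "y - (\<Sum>i. h (\<rho> i))"] csubspace_diff[OF G(1) xy] by fastforce
    moreover have "norm (\<Sum>i. h (\<rho> i)) \<le> (\<Sum>m. (k * norm x) * (1/2) ^ m)"
      using h_le sums_summable[OF geo] by (rule norm_suminf_le)
    ultimately show ?thesis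
      using sums_unique[OF geo] by (simp add: mult_ac)
  qed
  have "x \<in> closure (fst ` G)" for x
    using total[of x] closure_subset[of "fst ` G"] by force
  then show thesis
    using operator_of_bounded_relation[OF G(1) bound] that closure_closed[OF G(2)] by metis
qed

text \<open>
  Requiring solutions \<open>y\<close> of \<open>B y = A x\<close> to be orthogonal to the kernel of \<open>B\<close> makes them unique.
  The relation so defined is closed because \<open>A\<close> and \<open>B\<close> are continuous, so the closed graph
  theorem applies to it.
\<close>

lemma range_inclusion_factorization:
  fixes A :: "'a::chilbert_space \<Rightarrow> 'c::chilbert_space" and B :: "'b::chilbert_space \<Rightarrow> 'c"
  assumes A: "bounded_clinear A" and B: "bounded_clinear B" and ran: "range A \<subseteq> range B"
  obtains C where "bounded_clinear C" and "\<And>x. B (C x) = A x"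
    and "\<And>x. C x \<in> orth_compl (ker_op B)"
proof -
  have kB: "csubspace (ker_op B)" "closed (ker_op B)"
    using B by (rule csubspace_ker closed_ker)+
  define G where "G = {p. B (snd p) = A (fst p)} \<inter> snd -` orth_compl (ker_op B)"
  have "csubspace G"
    using csubspace_orth_compl[of "ker_op B"] unfolding G_def csubspace_def
    by (auto simp: scaleC_prod_def bounded_clinear_0[OF A] bounded_clinear_0[OF B]
        bounded_clinear_add[OF A] bounded_clinear_add[OF B]
        bounded_clinear_scaleC[OF A] bounded_clinear_scaleC[OF B])
  moreover have "closed G"
    unfolding G_def
    by (intro closed_Int closed_Collect_eq closed_vimage closed_orth_compl continuous_intros
        linear_continuous_on bounded_clinear_bounded_linear
        bounded_clinear_compose[OF A] bounded_clinear_compose[OF B] bounded_clinear_fst bounded_clinear_snd)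
  moreover have "\<exists>y. (x, y) \<in> G" for x
  proof -
    obtain y where y: "A x = B y"
      using ran by blast
    have "B (cproj (ker_op B) y) = 0"
      using cproj_mem[OF kB, of y] by (simp add: ker_op_def)
    then have "(x, y - cproj (ker_op B) y) \<in> G"
      using diff_cproj_mem[OF kB, of y] by (simp add: G_def y bounded_clinear_diff[OF B])
    then show ?thesis ..
  qed
  moreover have "y = 0" if "(0, y) \<in> G" for y
  proof -
    have "y \<in> ker_op B" "y \<in> orth_compl (ker_op B)"
      using that by (auto simp: G_def ker_op_def bounded_clinear_0[OF A])
    then have "cinner y y = 0"
      by (simp add: orth_compl_def)
    then show ?thesis by simp
  qed
  ultimately obtain C where "bounded_clinear C" "\<And>x. (x, C x) \<in> G"
    using operator_of_closed_graph by metis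
  then show thesis
    using that[of C] by (simp add: G_def)
qed

section \<open>Equivalence of operators\<close>

lemma invertible_opI:
  assumes "bounded_clinear T" and "bounded_clinear S"
    and "\<And>x. S (T x) = x" and "\<And>y. T (S y) = y"
  shows "invertible_op T"
  using assms unfolding invertible_op_def by (intro conjI exI[of _ S]) (auto simp: fun_eq_iff)

lemma invertible_opE:
  assumes "invertible_op T"
  obtains S where "bounded_clinear T" and "bounded_clinear S" and "invertible_op S"
    and "\<And>x. S (T x) = x" and "\<And>y. T (S y) = y"
proof -
  obtain S where "bounded_clinear T" "bounded_clinear S" "\<And>x. S (T x) = x" "\<And>y. T (S y) = y"
    using assms unfolding invertible_op_def by (metis comp_apply id_apply)
  then show thesis
    using that invertible_opI by metis
qed

lemma subspace_system_summands_graph: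
  assumes T: "bounded_clinear T"
  shows "subspace_system [UNIV \<times> {0}, {0} \<times> UNIV, graph_op T]"
proof -
  have "graph_op T = ker_op (\<lambda>p. T (fst p) - snd p)"
    by (auto simp: graph_op_def ker_op_def)
  moreover have "UNIV \<times> {0} = ker_op (snd :: 'a \<times> 'b \<Rightarrow> 'b)"
    and "{0} \<times> UNIV = ker_op (fst :: 'a \<times> 'b \<Rightarrow> 'a)"
    by (auto simp: ker_op_def)
  moreover have "bounded_clinear (\<lambda>p. T (fst p) - snd p)"
    using T by (auto simp: bounded_clinear_def scaleC_prod_def cspace.scale_right_diff_distrib
        intro!: bounded_linear_sub bounded_linear_compose[of T] bounded_linear_fst bounded_linear_snd)
  ultimately show ?thesis
    using bounded_clinear_fst bounded_clinear_snd
    by (auto simp: subspace_system_def intro: csubspace_ker closed_ker)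
qed

text \<open>
  An isomorphism preserving the first summand is a triangular operator matrix. Its
  lower diagonal entry \<open>D\<close> is invertible, since the inverse isomorphism is
  triangular too, and restricting the isomorphism to the graphs, each parametrized by the first
  space, yields an invertible \<open>M\<close>. Comparing second components on the graph gives
  \<open>D T = T' M\<close>.
\<close>

lemma intertwining_of_two_subspace_isomorphism:
  fixes T T' :: "'a::chilbert_space \<Rightarrow> 'b::chilbert_space"
  assumes T: "bounded_clinear T" and T': "bounded_clinear T'"
    and \<phi>: "invertible_op \<phi>" and summand: "\<phi> ` (UNIV \<times> {0}) = UNIV \<times> {0}"
    and graph: "\<phi> ` graph_op T = graph_op T'"
  shows "\<exists>L M. invertible_op L \<and> invertible_op M \<and> T = L \<circ> T' \<circ> M"
proof -
  obtain \<psi> where bc: "bounded_clinear \<phi>" "bounded_clinear \<psi>"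
    and inv: "\<And>p. \<psi> (\<phi> p) = p" "\<And>q. \<phi> (\<psi> q) = q"
    using invertible_opE[OF \<phi>] by metis
  have summand': "\<psi> ` (UNIV \<times> {0}) = UNIV \<times> {0}"
    using arg_cong[OF summand, of "image \<psi>"] by (simp only: image_image inv image_ident)
  have graph': "\<psi> ` graph_op T' = graph_op T"
    unfolding graph[symmetric] image_image inv by simp
  define M where "M x = fst (\<phi> (x, T x))" for x
  define M' where "M' y = fst (\<psi> (y, T' y))" for y
  have \<phi>_graph: "\<phi> (x, T x) = (M x, T' (M x))" for x
  proof -
    have "\<phi> (x, T x) \<in> graph_op T'"
      unfolding graph[symmetric] by (intro imageI) (simp add: graph_op_def)
    then show ?thesis
      by (auto simp: graph_op_def M_def)
  qed
  have \<psi>_graph: "\<psi> (y, T' y) = (M' y, T (M' y))" for y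
  proof -
    have "\<psi> (y, T' y) \<in> graph_op T"
      unfolding graph'[symmetric] by (intro imageI) (simp add: graph_op_def)
    then show ?thesis
      by (auto simp: graph_op_def M'_def)
  qed
  have M: "invertible_op M"
  proof (rule invertible_opI)
    show "bounded_clinear M" "bounded_clinear M'"
      unfolding M_def M'_def
      by (intro bounded_clinear_compose[OF bounded_clinear_fst] bounded_clinear_compose[OF bc(1)]
          bounded_clinear_compose[OF bc(2)] bounded_clinear_Pair bounded_clinear_id T T')+
    show "M' (M x) = x" for x
      using inv(1)[of "(x, T x)"] by (simp add: \<phi>_graph \<psi>_graph)
    show "M (M' y) = y" for y
      using inv(2)[of "(y, T' y)"] by (simp add: \<phi>_graph \<psi>_graph)
  qed
  define D where "D y = snd (\<phi> (0, y))" for y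
  define D' where "D' y = snd (\<psi> (0, y))" for y
  \<comment> \<open>the zero below the diagonal\<close>
  have snd_\<phi>: "snd (\<phi> p) = D (snd p)" for p
  proof -
    have "\<phi> (fst p, 0) \<in> UNIV \<times> {0}"
      using summand by blast
    moreover have "\<phi> p = \<phi> (fst p, 0) + \<phi> (0, snd p)"
      by (simp add: bounded_clinear_add[OF bc(1), symmetric])
    ultimately show ?thesis
      by (simp add: D_def mem_Times_iff)
  qed
  have snd_\<psi>: "snd (\<psi> p) = D' (snd p)" for p
  proof -
    have "\<psi> (fst p, 0) \<in> UNIV \<times> {0}"
      using summand' by blast
    moreover have "\<psi> p = \<psi> (fst p, 0) + \<psi> (0, snd p)"
      by (simp add: bounded_clinear_add[OF bc(2), symmetric])
    ultimately show ?thesis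
      by (simp add: D'_def mem_Times_iff)
  qed
  have D'D: "D' (D y) = y" and DD': "D (D' y) = y" for y
    using inv(1)[of "(0, y)"] inv(2)[of "(0, y)"] snd_\<psi>[of "\<phi> (0, y)"] snd_\<phi>[of "\<psi> (0, y)"]
    by (simp_all add: D_def D'_def)
  have "invertible_op D'"
  proof (rule invertible_opI)
    show "bounded_clinear D'" "bounded_clinear D"
      unfolding D_def D'_def
      by (intro bounded_clinear_compose[OF bounded_clinear_snd] bounded_clinear_compose[OF bc(1)]
          bounded_clinear_compose[OF bc(2)] bounded_clinear_Pair bounded_clinear_id bounded_clinear_zero)+
  qed (simp_all add: D'D DD')
  moreover have "T = D' \<circ> T' \<circ> M"
  proof
    fix x
    have "T' (M x) = D (T x)"
      using snd_\<phi>[of "(x, T x)"] by (simp add: \<phi>_graph)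
    then show "T x = (D' \<circ> T' \<circ> M) x"
      by (simp add: D'D)
  qed
  ultimately show ?thesis
    using M by blast
qed

text \<open>
  Let the unitary \<open>U\<close> map \<open>range T\<close> onto \<open>range T'\<close>. Factorization through the ranges provides
  bounded operators \<open>C\<close> and \<open>C'\<close> with \<open>T' C = U T\<close> and \<open>T C' = U\<^sup>* T'\<close>; they vanish on the kernels and
  are inverse to each other between the orthogonal complements of the kernels. Equality of the
  dimensions provides an isometry \<open>V\<close> between the kernels themselves. Their sum \<open>M\<close> is invertible and
  satisfies \<open>T' M = U T\<close>.
\<close>

lemma intertwining_of_range_and_kernel:
  fixes T T' :: "'a::chilbert_space \<Rightarrow> 'b::chilbert_space"
  assumes T: "bounded_clinear T" and T': "bounded_clinear T'"
    and ran: "unitarily_equivalent (range T) (range T')"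
    and dim: "(hilbert_dim (ker_op T), hilbert_dim (ker_op T')) \<in> ordIso"
  shows "\<exists>L M. invertible_op L \<and> invertible_op M \<and> T = L \<circ> T' \<circ> M"
proof -
  obtain U where U: "unitary_op U" and range_U: "range T' = U ` range T"
    using ran unfolding unitarily_equivalent_def by blast
  have bU: "bounded_clinear U" and U_cinner: "\<And>x y. cinner (U x) (U y) = cinner x y" and "surj U"
    using U by (auto simp: unitary_op_def)
  obtain Ua where Ua: "bounded_clinear Ua" "\<And>x y. cinner (U x) y = cinner x (Ua y)"
    using adjoint_exists[OF bU] by blast
  have UaU: "Ua (U x) = x" for x
  proof -
    have "cinner (Ua (U x) - x) (Ua (U x) - x) = 0"
      using Ua(2)[of "Ua (U x) - x" "U x"] U_cinner[of "Ua (U x) - x" x]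
      by (simp add: cinner_diff_right)
    then show ?thesis by simp
  qed
  have UUa: "U (Ua y) = y" for y
    using \<open>surj U\<close> UaU by (metis surj_def)
  have UT: "bounded_clinear (\<lambda>x. U (T x))"
    by (rule bounded_clinear_compose[OF bU T])
  have UT': "bounded_clinear (\<lambda>x. Ua (T' x))"
    by (rule bounded_clinear_compose[OF Ua(1) T'])
  have k: "csubspace (ker_op T)" "closed (ker_op T)"
    using T by (rule csubspace_ker closed_ker)+
  have k': "csubspace (ker_op T')" "closed (ker_op T')"
    using T' by (rule csubspace_ker closed_ker)+
  have "range (\<lambda>x. U (T x)) \<subseteq> range T'"
    using range_U by auto
  then obtain C where C: "bounded_clinear C" "\<And>x. T' (C x) = U (T x)"
      "\<And>x. C x \<in> orth_compl (ker_op T')"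
    using range_inclusion_factorization[OF UT T'] by blast
  have "Ua (T' x) \<in> range T" for x
  proof -
    obtain z where "T' x = U (T z)"
      using range_U by blast
    then show ?thesis
      by (simp add: UaU)
  qed
  then have "range (\<lambda>x. Ua (T' x)) \<subseteq> range T"
    by blast
  then obtain C' where C': "bounded_clinear C'" "\<And>x. T (C' x) = Ua (T' x)"
      "\<And>x. C' x \<in> orth_compl (ker_op T)"
    using range_inclusion_factorization[OF UT' T] by blast
  obtain V V' where V: "bounded_clinear V" "bounded_clinear V'"
      "\<And>x. x \<in> ker_op T \<Longrightarrow> V x \<in> ker_op T' \<and> V' (V x) = x \<and> norm (V x) = norm x"
      "\<And>y. y \<in> ker_op T' \<Longrightarrow> V' y \<in> ker_op T \<and> V (V' y) = y"
    using isometries_of_hilbert_dim_eq[OF k k' dim] by blast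
  define P where "P = cproj (ker_op T)"
  define P' where "P' = cproj (ker_op T')"
  have P: "bounded_clinear P" "\<And>x. P x \<in> ker_op T" "\<And>x. x \<in> ker_op T \<Longrightarrow> P x = x"
      "\<And>x. x \<in> orth_compl (ker_op T) \<Longrightarrow> P x = 0"
    unfolding P_def using k by (auto intro: bounded_clinear_cproj cproj_mem cproj_ident cproj_eq_0)
  have P': "bounded_clinear P'" "\<And>x. P' x \<in> ker_op T'" "\<And>x. x \<in> ker_op T' \<Longrightarrow> P' x = x"
      "\<And>x. x \<in> orth_compl (ker_op T') \<Longrightarrow> P' x = 0"
    unfolding P'_def using k' by (auto intro: bounded_clinear_cproj cproj_mem cproj_ident cproj_eq_0)
  have C'C: "C' (C x) = x - P x" for x
  proof -
    have "T (C' (C x)) = T x"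
      by (simp add: C'(2) C(2) UaU)
    moreover have "T (P x) = 0"
      using P(2) by (simp add: ker_op_def)
    ultimately have "C' (C x) - (x - P x) \<in> ker_op T"
      by (simp add: ker_op_def bounded_clinear_diff[OF T])
    moreover have "C' (C x) - (x - P x) \<in> orth_compl (ker_op T)"
      unfolding P_def
      by (intro csubspace_diff[OF csubspace_orth_compl] C'(3) diff_cproj_mem k)
    ultimately have "C' (C x) - (x - P x) = 0"
      using P(3,4) by metis
    then show ?thesis by simp
  qed
  have CC': "C (C' y) = y - P' y" for y
  proof -
    have "T' (C (C' y)) = T' y"
      by (simp add: C'(2) C(2) UUa)
    moreover have "T' (P' y) = 0"
      using P'(2) by (simp add: ker_op_def)
    ultimately have "C (C' y) - (y - P' y) \<in> ker_op T'"
      by (simp add: ker_op_def bounded_clinear_diff[OF T'])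
    moreover have "C (C' y) - (y - P' y) \<in> orth_compl (ker_op T')"
      unfolding P'_def
      by (intro csubspace_diff[OF csubspace_orth_compl] C(3) diff_cproj_mem k')
    ultimately have "C (C' y) - (y - P' y) = 0"
      using P'(3,4) by metis
    then show ?thesis by simp
  qed
  have C_ker: "C x = 0" if "x \<in> ker_op T" for x
  proof -
    have "C x \<in> ker_op T'"
      using that C(2)[of x] by (simp add: ker_op_def bounded_clinear_0[OF bU])
    then show ?thesis
      using C(3)[of x] P'(3,4) by metis
  qed
  have C'_ker: "C' y = 0" if "y \<in> ker_op T'" for y
  proof -
    have "C' y \<in> ker_op T"
      using that C'(2)[of y] by (simp add: ker_op_def bounded_clinear_0[OF Ua(1)])
    then show ?thesis
      using C'(3)[of y] P(3,4) by metis
  qed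
  define M where "M x = C x + V (P x)" for x
  define M' where "M' y = C' y + V' (P' y)" for y
  have "invertible_op M"
  proof (rule invertible_opI)
    show "bounded_clinear M" "bounded_clinear M'"
      unfolding M_def M'_def
      by (intro bounded_clinear_plus bounded_clinear_compose[OF V(1)] bounded_clinear_compose[OF V(2)]
          C(1) C'(1) P(1) P'(1))+
    show "M' (M x) = x" for x
      using V(3)[OF P(2), of x]
      by (simp add: M_def M'_def bounded_clinear_add[OF C'(1)] bounded_clinear_add[OF P'(1)]
          C'C C'_ker P'(3) P'(4)[OF C(3)])
    show "M (M' y) = y" for y
      using V(4)[OF P'(2), of y]
      by (simp add: M_def M'_def bounded_clinear_add[OF C(1)] bounded_clinear_add[OF P(1)]
          CC' C_ker P(3) P(4)[OF C'(3)])
  qed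
  moreover have "invertible_op Ua"
    by (rule invertible_opI[OF Ua(1) bU UUa UaU])
  moreover have "T = Ua \<circ> T' \<circ> M"
  proof
    fix x
    have "T' (V (P x)) = 0"
      using V(3)[OF P(2), of x] by (simp add: ker_op_def)
    then show "T x = (Ua \<circ> T' \<circ> M) x"
      by (simp add: M_def bounded_clinear_add[OF T'] C(2) UaU)
  qed
  ultimately show ?thesis by blast
qed

text \<open>
  \<open>M\<close> maps the kernel of \<open>T\<close> onto that of \<open>T'\<close>, and the ranges differ by the invertible \<open>L\<close>
  alone, because \<open>M\<close> is surjective.
\<close>

lemma range_and_kernel_of_intertwining:
  fixes T T' :: "'a::chilbert_space \<Rightarrow> 'b::chilbert_space"
  assumes T: "bounded_clinear T" and T': "bounded_clinear T'"
    and L: "invertible_op L" and M: "invertible_op M" and eq: "T = L \<circ> T' \<circ> M"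
  shows "unitarily_equivalent (range T) (range T')"
    and "(hilbert_dim (ker_op T), hilbert_dim (ker_op T')) \<in> ordIso"
proof -
  obtain J where J: "bounded_clinear L" "bounded_clinear J" "invertible_op J"
    "\<And>x. J (L x) = x" "\<And>y. L (J y) = y"
    using invertible_opE[OF L] by metis
  obtain M' where M': "bounded_clinear M" "bounded_clinear M'" "\<And>x. M' (M x) = x" "\<And>y. M (M' y) = y"
    using invertible_opE[OF M] by metis
  have "range T' = range (\<lambda>x. J (T x))"
  proof -
    have "J (T x) = T' (M x)" for x
      by (simp add: eq J(4))
    moreover have "T' x = J (T (M' x))" for x
      by (simp add: eq J(4) M'(4))
    ultimately show ?thesis
      by (metis (no_types, lifting) image_subsetI rangeI subset_antisym)
  qed
  then show "unitarily_equivalent (range T) (range T')"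
    using unitarily_equivalent_range_invertible_compose[OF T J(3)] by simp
  have "L y = 0 \<longleftrightarrow> y = 0" for y
    using J(4) bounded_clinear_0[OF J(1)] bounded_clinear_0[OF J(2)] by metis
  then have ker: "x \<in> ker_op T \<longleftrightarrow> M x \<in> ker_op T'" for x
    by (simp add: ker_op_def eq)
  have im: "M ` ker_op T = ker_op T'"
  proof
    show "M ` ker_op T \<subseteq> ker_op T'"
      using ker by blast
    show "ker_op T' \<subseteq> M ` ker_op T"
      using ker M'(4) by (metis image_iff subsetI)
  qed
  then have im': "M' ` ker_op T' = ker_op T"
    by (metis (no_types, lifting) M'(3) image_cong image_ident image_image)
  show "(hilbert_dim (ker_op T), hilbert_dim (ker_op T')) \<in> ordIso"
    unfolding ordIso_iff_ordLeq
    using hilbert_dim_image_le[OF M'(1) _ _ _ _ im] hilbert_dim_image_le[OF M'(2) _ _ _ _ im']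
      csubspace_ker[OF T] closed_ker[OF T] csubspace_ker[OF T'] closed_ker[OF T'] by blast
qed

text \<open>
  The diagonal operator \<open>M \<oplus> L\<inverse>\<close> preserves both summands and maps the graph of \<open>T\<close> onto
  that of \<open>T'\<close>, since \<open>L\<inverse> T = T' M\<close>.
\<close>

lemma three_subspace_isomorphism_of_intertwining:
  fixes T T' :: "'a::chilbert_space \<Rightarrow> 'b::chilbert_space"
  assumes T: "bounded_clinear T" and T': "bounded_clinear T'"
    and L: "invertible_op L" and M: "invertible_op M" and eq: "T = L \<circ> T' \<circ> M"
  shows "boundedly_isomorphic_systems
    [UNIV \<times> {0}, {0} \<times> UNIV, graph_op T] [UNIV \<times> {0}, {0} \<times> UNIV, graph_op T']"
proof -
  obtain J where J: "bounded_clinear L" "bounded_clinear J"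
    "\<And>x. J (L x) = x" "\<And>y. L (J y) = y"
    using invertible_opE[OF L] by metis
  obtain M' where M': "bounded_clinear M" "bounded_clinear M'" "\<And>x. M' (M x) = x" "\<And>y. M (M' y) = y"
    using invertible_opE[OF M] by metis
  define \<phi> where "\<phi> p = (M (fst p), J (snd p))" for p
  define \<psi> where "\<psi> p = (M' (fst p), L (snd p))" for p
  have \<psi>\<phi>: "\<psi> (\<phi> p) = p" and \<phi>\<psi>: "\<phi> (\<psi> p) = p" for p
    by (simp_all add: \<phi>_def \<psi>_def J(3,4) M'(3,4))
  have inv: "invertible_op \<phi>"
  proof (rule invertible_opI)
    show "bounded_clinear \<phi>" "bounded_clinear \<psi>"
      unfolding \<phi>_def \<psi>_def
      by (intro bounded_clinear_Pair bounded_clinear_compose[OF J(1)] bounded_clinear_compose[OF J(2)]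
          bounded_clinear_compose[OF M'(1)] bounded_clinear_compose[OF M'(2)] bounded_clinear_fst
          bounded_clinear_snd)+
  qed (rule \<psi>\<phi> \<phi>\<psi>)+
  have image_eqI': "\<phi> ` X = Y" if "\<And>p. p \<in> X \<longleftrightarrow> \<phi> p \<in> Y" for X Y
  proof
    show "\<phi> ` X \<subseteq> Y"
      using that by blast
    show "Y \<subseteq> \<phi> ` X"
      using that \<phi>\<psi> by (metis image_iff subsetI)
  qed
  have J0: "J y = 0 \<longleftrightarrow> y = 0" for y
    using J(4) bounded_clinear_0[OF J(1)] bounded_clinear_0[OF J(2)] by metis
  have M0: "M x = 0 \<longleftrightarrow> x = 0" for x
    using M'(3) bounded_clinear_0[OF M'(1)] bounded_clinear_0[OF M'(2)] by metis
  have gr: "p \<in> graph_op T \<longleftrightarrow> \<phi> p \<in> graph_op T'" for p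
  proof -
    have "p \<in> graph_op T \<longleftrightarrow> snd p = L (T' (M (fst p)))"
      by (cases p) (auto simp: graph_op_def eq)
    also have "\<dots> \<longleftrightarrow> J (snd p) = T' (M (fst p))"
      using J(3,4) by metis
    also have "\<dots> \<longleftrightarrow> \<phi> p \<in> graph_op T'"
      by (auto simp: graph_op_def \<phi>_def)
    finally show ?thesis .
  qed
  have "\<phi> ` (UNIV \<times> {0}) = UNIV \<times> {0}" "\<phi> ` ({0} \<times> UNIV) = {0} \<times> UNIV"
      "\<phi> ` graph_op T = graph_op T'"
    by (rule image_eqI', simp add: \<phi>_def mem_Times_iff J0 M0, rule image_eqI',
        simp add: \<phi>_def mem_Times_iff J0 M0, rule image_eqI', rule gr)
  then have "\<forall>i<length [UNIV \<times> {0}, {0} \<times> UNIV, graph_op T].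
      \<phi> ` ([UNIV \<times> {0}, {0} \<times> UNIV, graph_op T] ! i) = [UNIV \<times> {0}, {0} \<times> UNIV, graph_op T'] ! i"
    by (auto simp: less_Suc_eq)
  then show ?thesis
    unfolding boundedly_isomorphic_systems_def
    using subspace_system_summands_graph[OF T] subspace_system_summands_graph[OF T'] inv
    by (metis length_Cons)
qed

lemma two_subspace_isomorphism_of_three:
  assumes "boundedly_isomorphic_systems [E1, E2, E3] [F1, F2, F3]"
  shows "boundedly_isomorphic_systems [E1, E3] [F1, F3]"
proof -
  obtain \<phi> where \<phi>: "invertible_op \<phi>" "\<And>i. i < 3 \<Longrightarrow> \<phi> ` ([E1, E2, E3] ! i) = [F1, F2, F3] ! i"
    and "subspace_system [E1, E2, E3]" "subspace_system [F1, F2, F3]"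
    using assms unfolding boundedly_isomorphic_systems_def by auto
  moreover have "\<phi> ` E1 = F1" "\<phi> ` E3 = F3"
    using \<phi>(2)[of 0] \<phi>(2)[of 2] by simp_all
  ultimately show ?thesis
    unfolding boundedly_isomorphic_systems_def subspace_system_def
    by (auto simp: less_Suc_eq intro!: exI[of _ \<phi>])
qed

lemma isomorphic_representations_iff_intertwining:
  fixes T T' :: "'a::chilbert_space \<Rightarrow> 'b::chilbert_space"
  assumes T: "bounded_clinear T" and T': "bounded_clinear T'"
  shows "boundedly_isomorphic_representations T T' \<longleftrightarrow>
    (\<exists>(L :: 'b \<Rightarrow> 'b) (M :: 'a \<Rightarrow> 'a). invertible_op L \<and> invertible_op M \<and> T = L \<circ> T' \<circ> M)"
proof
  assume "boundedly_isomorphic_representations T T'"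
  then obtain M J where M: "invertible_op M" "invertible_op J" and JT: "J \<circ> T = T' \<circ> M"
    unfolding boundedly_isomorphic_representations_def by blast
  obtain L where L: "invertible_op L" "\<And>y. L (J y) = y"
    using invertible_opE[OF M(2)] by metis
  have "T = L \<circ> T' \<circ> M"
  proof
    show "T x = (L \<circ> T' \<circ> M) x" for x
      using fun_cong[OF JT, of x] L(2)[of "T x"] by simp
  qed
  then show "\<exists>L M. invertible_op L \<and> invertible_op M \<and> T = L \<circ> T' \<circ> M"
    using M L by blast
next
  assume "\<exists>(L :: 'b \<Rightarrow> 'b) (M :: 'a \<Rightarrow> 'a). invertible_op L \<and> invertible_op M \<and> T = L \<circ> T' \<circ> M"
  then obtain L M where LM: "invertible_op L" "invertible_op M" "T = L \<circ> T' \<circ> M"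
    by blast
  obtain J where J: "invertible_op J" "\<And>x. J (L x) = x"
    using invertible_opE[OF LM(1)] by metis
  have "J \<circ> T = T' \<circ> M"
    by (simp add: fun_eq_iff LM(3) J(2))
  then show "boundedly_isomorphic_representations T T'"
    unfolding boundedly_isomorphic_representations_def A2_representation_def
    using T T' J(1) LM(2) by blast
qed

theorem theorem2p2:
  fixes T T' :: "'a::chilbert_space \<Rightarrow> 'b::chilbert_space"
  assumes "bounded_clinear T" and "bounded_clinear T'"
  shows "all_equivalent
    [boundedly_isomorphic_systems
       [UNIV \<times> {0}, graph_op T]
       [UNIV \<times> {0}, graph_op T'],
     boundedly_isomorphic_systems
       [UNIV \<times> {0}, {0} \<times> UNIV, graph_op T]
       [UNIV \<times> {0}, {0} \<times> UNIV, graph_op T'],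
     boundedly_isomorphic_representations T T',
     unitarily_equivalent (range T) (range T') \<and>
       (hilbert_dim (ker_op T), hilbert_dim (ker_op T')) \<in> ordIso,
     \<exists>(L :: 'b \<Rightarrow> 'b) (M :: 'a \<Rightarrow> 'a).
       invertible_op L \<and> invertible_op M \<and> T = L \<circ> T' \<circ> M]"
    (is "all_equivalent [?two, ?three, ?rep, ?ran, ?factor]")
proof -
  have "?factor" if two: ?two
  proof -
    obtain \<phi> where \<phi>: "invertible_op \<phi>"
      and \<phi>_i: "\<forall>i<2. \<phi> ` ([UNIV \<times> {0}, graph_op T] ! i) = [UNIV \<times> {0}, graph_op T'] ! i"
      using two unfolding boundedly_isomorphic_systems_def by (auto simp: numeral_2_eq_2)
    have "\<phi> ` (UNIV \<times> {0}) = UNIV \<times> {0}" "\<phi> ` graph_op T = graph_op T'"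
      using spec[OF \<phi>_i, of 0] spec[OF \<phi>_i, of 1] by simp_all
    then show ?thesis
      by (rule intertwining_of_two_subspace_isomorphism[OF assms \<phi>])
  qed
  moreover have ?three if ?factor
    using that three_subspace_isomorphism_of_intertwining[OF assms] by blast
  moreover have ?two if ?three
    using that by (rule two_subspace_isomorphism_of_three)
  moreover have "?rep \<longleftrightarrow> ?factor"
    by (rule isomorphic_representations_iff_intertwining[OF assms])
  moreover have ?factor if ?ran
    using that intertwining_of_range_and_kernel[OF assms] by blast
  moreover have ?ran if ?factor
    using that range_and_kernel_of_intertwining[OF assms] by blast
  ultimately have "?two = ?factor" "?three = ?factor" "?rep = ?factor" "?ran = ?factor"
    by argo+
  then show ?thesis
    unfolding all_equivalent_def by simp
qed

end
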